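(* Let $G_\mu$ be a group of $\mu$-good symmetries of $(Q,L_d)$, $\mu\in\mathfrak g^*$. The force $\breve f_\mu$ coincides with the 1-form $-\breve{\mathscr A}_\mu$ on $(Q/G_\mu)\times(Q/G_\mu)$, that is, $$\breve f_\mu=-\breve{\mathscr A}_\mu.$$
   Context: For a smooth $H$ on a product manifold, $D_iH$ denotes the partial tangent map in the $i$-th factor. $Q$ is a smooth manifold and $L_d:Q\times Q\to\mathbb R$ a smooth discrete Lagrangian that is regular: $\mathbb F^+L_d(q_0,q_1)=(q_1,D_2L_d(q_0,q_1))$ and $\mathbb F^-L_d(q_0,q_1)=(q_0,-D_1L_d(q_0,q_1))$ are local diffeomorphisms $Q\times Q\to T^*Q$. A Lie group $G$ with Lie algebra $\mathfrak g$ acts on $Q$ freely and properly by a left action $l^Q$, and $L_d$ is invariant under the diagonal action. $\xi_Q$ is the infinitesimal generator of $\xi$. For $\mu\in\mathfrak g^*$, $G_\mu=\{g\in G:\mathrm{Ad}^*_{g^{-1}}\mu=\mu\}$ with Lie algebra $\mathfrak g_\mu$; $\pi_\mu:Q\to Q/G_\mu$ is the quotient principal bundle; $\mu$ also denotes its restriction to $\mathfrak g_\mu$. The momentum map $J_\mu:Q\times Q\to\mathfrak g_\mu^*$ is $J_\mu(q_0,q_1)\xi=-D_1L_d(q_0,q_1)\xi_Q(q_0)=D_2L_d(q_0,q_1)\xi_Q(q_1)$. $G_\mu$ is a group of $\mu$-good symmetries if $L_d$ is regular, for all $(q_0,q_1)$ the restriction of the bilinear form $D_2D_1L_d(q_0,q_1):T_{q_0}Q\times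 T_{q_1}Q\to\mathbb R$ to $T_{q_0}(G_\mu\cdot q_0)\times T_{q_1}(G_\mu\cdot q_1)$ is nondegenerate, and for each $q\in Q$ there is a unique $g\in G_\mu$ with $J_\mu(q,l^Q_g(q))=\mu$. Standing assumption: for all $(q_0,q_1)\in Q\times Q$ there is a unique $g\in G_\mu$ with $J_\mu(q_0,l^Q_{g^{-1}}(q_1))=\mu$, and the map $\mathcal A_\mu:Q\times Q\to G_\mu$, $\mathcal A_\mu(q_0,q_1):=g$, is smooth (the affine discrete connection associated to $J_\mu$). Then $\mathcal A_\mu(l^Q_{g_0}q_0,l^Q_{g_1}q_1)=g_1\mathcal A_\mu(q_0,q_1)g_0^{-1}$ and $\mathcal A_\mu(q_0,q_1)=e\iff J_\mu(q_0,q_1)=\mu$. For $q_0\in Q$, $\tau_1\in Q/G_\mu$, $\overline{h^{q_0}_{d,\mu}}(\tau_1)$ is the unique $q_1\in Q$ with $\pi_\mu(q_1)=\tau_1$ and $J_\mu(q_0,q_1)=\mu$. A principal connection $\mathfrak A:TQ\to\mathfrak g_\mu$ on $\pi_\mu$ is fixed ($\mathfrak A(\xi_Q(q))=\xi$, $\mathfrak A(Tl^Q_g v)=\mathrm{Ad}_g\mathfrak A(v)$), with horizontal lift $h_\mu^q:T_{\pi_\mu(q)}(Q/G_\mu)\to T_qQ$. Define $\check L_\mu:Q\times G_\mu\times(Q/G_\mu)\to\mathbb R$, $\check L_\mu(q_0,w,\tau_1):=L_d\big(q_0,l^Q_w(\overline{h^{q_0}_{d,\mu}}(\tau_1))\big)$,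 and $$\breve f_\mu(\tau_0,\tau_1)(\delta\tau_0,\delta\tau_1):=D_2\check L_\mu(q_0,e,\tau_1)\big(T_{(q_0,q_1)}\mathcal A_\mu(h_\mu^{q_0}(\delta\tau_0),h_\mu^{q_1}(\delta\tau_1))\big)$$ with $q_0\in\pi_\mu^{-1}(\tau_0)$, $q_1=\overline{h^{q_0}_{d,\mu}}(\tau_1)$. Let $\mathfrak A_\mu$ be the 1-form on $Q$ with $\mathfrak A_\mu(q)(\delta q):=\langle\mu,\mathfrak A(\delta q)\rangle$, and $\mathscr A_\mu:=\mathrm{pr}_2^*\mathfrak A_\mu-\mathrm{pr}_1^*\mathfrak A_\mu$ on $Q\times Q$, $\mathrm{pr}_i:Q\times Q\to Q$ being the projections. The restriction of $\mathscr A_\mu$ to the submanifold $J_\mu^{-1}(\mu)$ drops to $J_\mu^{-1}(\mu)/G_\mu\cong(Q/G_\mu)\times(Q/G_\mu)$ (identification $[q_0,q_1]\mapsto(\pi_\mu(q_0),\pi_\mu(q_1))$), giving the 1-form $\breve{\mathscr A}_\mu$: it is the unique 1-form with $\breve{\mathscr A}_\mu(\pi_\mu(q_0),\pi_\mu(q_1))(T\pi_\mu\delta q_0,T\pi_\mu\delta q_1)=\mathfrak A_\mu(q_1)(\delta q_1)-\mathfrak A_\mu(q_0)(\delta q_0)$ for all $(\delta q_0,\delta q_1)\in T_{(q_0,q_1)}J_\mu^{-1}(\mu)$. *)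

theory Defs
  imports "HOL-Analysis.Analysis" "HOL-Algebra.Group_Action"
begin

section \<open>Smooth maps between normed spaces\<close>

text \<open>All model spaces below are finite-dimensional, so asking every directional derivative to be
  of class \<open>C\<^sup>k\<close> amounts to asking the derivative itself to be. The sort is \<open>real_normed_vector\<close>
  together with finite dimension, rather than \<open>euclidean_space\<close>, because the latter excludes
  dimension \<open>0\<close> (discrete symmetry groups, one-point quotients).\<close>

fun Ck_on :: "nat \<Rightarrow> 'a::real_normed_vector set \<Rightarrow> ('a \<Rightarrow> 'b::real_normed_vector) \<Rightarrow> bool" where
  "Ck_on 0 S f \<longleftrightarrow> continuous_on S f"
| "Ck_on (Suc k) S f \<longleftrightarrow>
     (\<forall>x\<in>S. f differentiable at x) \<and> (\<forall>v. Ck_on k S (\<lambda>x. frechet_derivative f (at x) v))"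

definition smooth_on :: "'a::real_normed_vector set \<Rightarrow> ('a \<Rightarrow> 'b::real_normed_vector) \<Rightarrow> bool" where
  "smooth_on S f \<longleftrightarrow> (\<forall>k. Ck_on k S f)"

definition finite_dimensional :: "'a::real_normed_vector itself \<Rightarrow> bool" where
  "finite_dimensional _ \<longleftrightarrow> (\<exists>B::'a set. finite B \<and> span B = UNIV)"


section \<open>Smooth manifolds\<close>

text \<open>A chart is a pair of its domain and its coordinate map. A manifold is given by an atlas
  together with a preferred chart \<open>chart_at M p\<close> around every point \<open>p\<close>; the latter is only a
  device to represent tangent vectors: \<open>T\<^sub>pM\<close> is the model space \<open>'e\<close>, a vector \<open>v\<close> standing for the
  tangent vector at \<open>p\<close> whose coordinates in the chart \<open>chart_at M p\<close> are \<open>v\<close>.\<close>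

type_synonym ('a, 'e) chart = "'a set \<times> ('a \<Rightarrow> 'e)"

record ('a, 'e) manifold =
  atlas :: "('a, 'e) chart set"
  chart_at :: "'a \<Rightarrow> ('a, 'e) chart"

definition mcarrier :: "('a, 'e) manifold \<Rightarrow> 'a set" where
  "mcarrier M = (\<Union>c\<in>atlas M. fst c)"

definition mopen :: "('a, 'e::real_normed_vector) manifold \<Rightarrow> 'a set \<Rightarrow> bool" where
  "mopen M W \<longleftrightarrow> W \<subseteq> mcarrier M \<and> (\<forall>(U, \<phi>)\<in>atlas M. open (\<phi> ` (W \<inter> U)))"

definition mtopology :: "('a, 'e::real_normed_vector) manifold \<Rightarrow> 'a topology" where
  "mtopology M = topology (mopen M)"

definition smooth_manifold :: "('a, 'e::real_normed_vector) manifold \<Rightarrow> bool" where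
  "smooth_manifold M \<longleftrightarrow>
     finite_dimensional TYPE('e) \<and>
     (\<forall>(U, \<phi>)\<in>atlas M. inj_on \<phi> U \<and> open (\<phi> ` U)) \<and>
     (\<forall>(U, \<phi>)\<in>atlas M. \<forall>(V, \<psi>)\<in>atlas M.
        open (\<phi> ` (U \<inter> V)) \<and> smooth_on (\<phi> ` (U \<inter> V)) (\<psi> \<circ> inv_into U \<phi>)) \<and>
     (\<forall>p\<in>mcarrier M. chart_at M p \<in> atlas M \<and> p \<in> fst (chart_at M p)) \<and>
     Hausdorff_space (mtopology M) \<and> second_countable (mtopology M)"

lemma istopology_mopen:
  assumes "\<And>U \<phi>. (U, \<phi>) \<in> atlas M \<Longrightarrow> inj_on \<phi> U"
  shows "istopology (mopen M)"
  unfolding istopology_def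
proof (intro conjI allI impI)
  fix S T assume S: "mopen M S" and T: "mopen M T"
  have "open (\<phi> ` (S \<inter> T \<inter> U))" if c: "(U, \<phi>) \<in> atlas M" for U \<phi>
  proof -
    have "\<phi> ` (S \<inter> T \<inter> U) = \<phi> ` (S \<inter> U) \<inter> \<phi> ` (T \<inter> U)"
      using assms[OF c] by (auto simp: inj_on_def)
    then show ?thesis using S T c by (auto simp: mopen_def)
  qed
  then show "mopen M (S \<inter> T)" using S by (auto simp: mopen_def)
next
  fix \<K> assume K: "\<forall>S\<in>\<K>. mopen M S"
  have "open (\<phi> ` (\<Union>\<K> \<inter> U))" if c: "(U, \<phi>) \<in> atlas M" for U \<phi>
  proof -
    have "\<phi> ` (\<Union>\<K> \<inter> U) = (\<Union>S\<in>\<K>. \<phi> ` (S \<inter> U))" by auto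
    moreover have "\<forall>S\<in>\<K>. open (\<phi> ` (S \<inter> U))" using K c by (auto simp: mopen_def)
    ultimately show ?thesis by (simp add: open_UN)
  qed
  then show "mopen M (\<Union>\<K>)" using K by (auto simp: mopen_def)
qed

lemma openin_mtopology:
  "smooth_manifold M \<Longrightarrow> openin (mtopology M) W \<longleftrightarrow> mopen M W"
  unfolding mtopology_def
  by (subst topology_inverse') (auto intro!: istopology_mopen simp: smooth_manifold_def)

definition vec_manifold :: "('e, 'e) manifold" where
  "vec_manifold = \<lparr>atlas = {(UNIV, \<lambda>x. x)}, chart_at = (\<lambda>_. (UNIV, \<lambda>x. x))\<rparr>"

definition prod_chart :: "('a, 'e) chart \<Rightarrow> ('b, 'f) chart \<Rightarrow> ('a \<times> 'b, 'e \<times> 'f) chart" where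
  "prod_chart c d = (fst c \<times> fst d, \<lambda>(x, y). (snd c x, snd d y))"

text \<open>With this choice of preferred charts, \<open>T\<^bsub>(p,q)\<^esub>(M \<times> N) = T\<^sub>pM \<times> T\<^sub>qN\<close> holds on the nose.\<close>

definition prod_manifold ::
  "('a, 'e) manifold \<Rightarrow> ('b, 'f) manifold \<Rightarrow> ('a \<times> 'b, 'e \<times> 'f) manifold" where
  "prod_manifold M N =
     \<lparr>atlas = {prod_chart c d | c d. c \<in> atlas M \<and> d \<in> atlas N},
      chart_at = (\<lambda>(p, q). prod_chart (chart_at M p) (chart_at N q))\<rparr>"

definition open_submanifold :: "('a, 'e) manifold \<Rightarrow> 'a set \<Rightarrow> ('a, 'e) manifold" where
  "open_submanifold M W =
     \<lparr>atlas = (\<lambda>(U, \<phi>). (U \<inter> W, \<phi>)) ` atlas M,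
      chart_at = (\<lambda>p. (fst (chart_at M p) \<inter> W, snd (chart_at M p)))\<rparr>"

text \<open>Openness of the sets \<open>\<phi> ` {p \<in> U. F p \<in> V}\<close> expresses continuity of \<open>F\<close>.\<close>

definition smooth_map ::
  "('a, 'e::real_normed_vector) manifold \<Rightarrow> ('b, 'f::real_normed_vector) manifold \<Rightarrow>
     ('a \<Rightarrow> 'b) \<Rightarrow> bool" where
  "smooth_map M N F \<longleftrightarrow>
     F ` mcarrier M \<subseteq> mcarrier N \<and>
     (\<forall>(U, \<phi>)\<in>atlas M. \<forall>(V, \<psi>)\<in>atlas N.
        open (\<phi> ` {p\<in>U. F p \<in> V}) \<and>
        smooth_on (\<phi> ` {p\<in>U. F p \<in> V}) (\<psi> \<circ> F \<circ> inv_into U \<phi>))"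

definition diffeomorphism ::
  "('a, 'e::real_normed_vector) manifold \<Rightarrow> ('b, 'f::real_normed_vector) manifold \<Rightarrow>
     ('a \<Rightarrow> 'b) \<Rightarrow> bool" where
  "diffeomorphism M N F \<longleftrightarrow>
     bij_betw F (mcarrier M) (mcarrier N) \<and>
     smooth_map M N F \<and> smooth_map N M (inv_into (mcarrier M) F)"

definition local_diffeomorphism ::
  "('a, 'e::real_normed_vector) manifold \<Rightarrow> ('b, 'f::real_normed_vector) manifold \<Rightarrow>
     ('a \<Rightarrow> 'b) \<Rightarrow> bool" where
  "local_diffeomorphism M N F \<longleftrightarrow>
     (\<forall>p\<in>mcarrier M. \<exists>W. openin (mtopology M) W \<and> p \<in> W \<and>
        openin (mtopology N) (F ` W) \<and>
        diffeomorphism (open_submanifold M W) (open_submanifold N (F ` W)) F)"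

text \<open>The tangent map \<open>T\<^sub>pF : T\<^sub>pM \<rightarrow> T\<^bsub>F p\<^esub>N\<close>.\<close>

definition tangent_map ::
  "('a, 'e::real_normed_vector) manifold \<Rightarrow> ('b, 'f::real_normed_vector) manifold \<Rightarrow>
     ('a \<Rightarrow> 'b) \<Rightarrow> 'a \<Rightarrow> 'e \<Rightarrow> 'f" where
  "tangent_map M N F p =
     frechet_derivative
       (snd (chart_at N (F p)) \<circ> F \<circ> inv_into (fst (chart_at M p)) (snd (chart_at M p)))
       (at (snd (chart_at M p) p))"

text \<open>The tangent space at \<open>p\<close> of an embedded submanifold \<open>S\<close> of \<open>M\<close>, as a subspace of \<open>T\<^sub>pM\<close>:
  velocities at \<open>p\<close> of smooth curves running in \<open>S\<close>.\<close>

definition tangent_space_sub ::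
  "('a, 'e::real_normed_vector) manifold \<Rightarrow> 'a set \<Rightarrow> 'a \<Rightarrow> 'e set" where
  "tangent_space_sub M S p =
     {tangent_map vec_manifold M \<gamma> 0 (1::real) | \<gamma>.
        \<exists>\<epsilon>>0. smooth_map (open_submanifold vec_manifold {-\<epsilon><..<\<epsilon>}) M \<gamma> \<and>
              \<gamma> ` {-\<epsilon><..<\<epsilon>} \<subseteq> S \<and> \<gamma> 0 = p}"

text \<open>Partial tangent maps of functions on a product with values in a vector space.\<close>

definition D1 ::
  "('a, 'e::real_normed_vector) manifold \<Rightarrow> ('a \<times> 'b \<Rightarrow> 'v::real_normed_vector) \<Rightarrow>
     'a \<Rightarrow> 'b \<Rightarrow> 'e \<Rightarrow> 'v" where
  "D1 M F p q = tangent_map M vec_manifold (\<lambda>x. F (x, q)) p"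

definition D2 ::
  "('b, 'f::real_normed_vector) manifold \<Rightarrow> ('a \<times> 'b \<Rightarrow> 'v::real_normed_vector) \<Rightarrow>
     'a \<Rightarrow> 'b \<Rightarrow> 'f \<Rightarrow> 'v" where
  "D2 N F p q = tangent_map N vec_manifold (\<lambda>y. F (p, y)) q"

text \<open>\<open>coord_change c d p\<close> maps the coordinates in the chart \<open>c\<close> of a tangent vector at \<open>p\<close> to its
  coordinates in the chart \<open>d\<close>.\<close>

definition coord_change ::
  "('a, 'e::real_normed_vector) chart \<Rightarrow> ('a, 'e) chart \<Rightarrow> 'a \<Rightarrow> 'e \<Rightarrow> 'e" where
  "coord_change c d p = frechet_derivative (snd d \<circ> inv_into (fst c) (snd c)) (at (snd c p))"

definition tangent_chart ::
  "('a, 'e::real_normed_vector) manifold \<Rightarrow> ('a, 'e) chart \<Rightarrow> ('a \<times> 'e, 'e \<times> 'e) chart" where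
  "tangent_chart M c =
     (fst c \<times> UNIV, \<lambda>(p, v). (snd c p, coord_change (chart_at M p) c p v))"

definition tangent_bundle ::
  "('a, 'e::real_normed_vector) manifold \<Rightarrow> ('a \<times> 'e, 'e \<times> 'e) manifold" where
  "tangent_bundle M =
     \<lparr>atlas = tangent_chart M ` atlas M, chart_at = (\<lambda>(p, v). tangent_chart M (chart_at M p))\<rparr>"

definition cotangent_chart ::
  "('a, 'e::real_normed_vector) manifold \<Rightarrow> ('a, 'e) chart \<Rightarrow>
     ('a \<times> ('e \<Rightarrow>\<^sub>L real), 'e \<times> ('e \<Rightarrow>\<^sub>L real)) chart" where
  "cotangent_chart M c =
     (fst c \<times> UNIV, \<lambda>(p, \<alpha>). (snd c p, \<alpha> o\<^sub>L Blinfun (coord_change c (chart_at M p) p)))"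

definition cotangent_bundle ::
  "('a, 'e::real_normed_vector) manifold \<Rightarrow>
     ('a \<times> ('e \<Rightarrow>\<^sub>L real), 'e \<times> ('e \<Rightarrow>\<^sub>L real)) manifold" where
  "cotangent_bundle M =
     \<lparr>atlas = cotangent_chart M ` atlas M,
      chart_at = (\<lambda>(p, \<alpha>). cotangent_chart M (chart_at M p))\<rparr>"

text \<open>1-forms are written as functions of a point and a tangent vector at this point.\<close>

definition pullback_form ::
  "('a, 'e::real_normed_vector) manifold \<Rightarrow> ('b, 'f::real_normed_vector) manifold \<Rightarrow>
     ('a \<Rightarrow> 'b) \<Rightarrow> ('b \<Rightarrow> 'f \<Rightarrow> real) \<Rightarrow> 'a \<Rightarrow> 'e \<Rightarrow> real" where
  "pullback_form M N F \<omega> p v = \<omega> (F p) (tangent_map M N F p v)"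


section \<open>Lie groups, actions and principal bundles\<close>

definition lie_group :: "('g, 'm) monoid_scheme \<Rightarrow> ('g, 'l::real_normed_vector) manifold \<Rightarrow> bool"
  where
  "lie_group G GM \<longleftrightarrow>
     group G \<and> smooth_manifold GM \<and> mcarrier GM = carrier G \<and>
     smooth_map (prod_manifold GM GM) GM (\<lambda>(g, h). g \<otimes>\<^bsub>G\<^esub> h) \<and>
     smooth_map GM GM (\<lambda>g. inv\<^bsub>G\<^esub> g)"

text \<open>The Lie algebra of a Lie group is its tangent space at the unit.\<close>

definition Ad ::
  "('g, 'm) monoid_scheme \<Rightarrow> ('g, 'l::real_normed_vector) manifold \<Rightarrow> 'g \<Rightarrow> 'l \<Rightarrow> 'l" where
  "Ad G GM g = tangent_map GM GM (\<lambda>h. g \<otimes>\<^bsub>G\<^esub> h \<otimes>\<^bsub>G\<^esub> inv\<^bsub>G\<^esub> g) \<one>\<^bsub>G\<^esub>"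

text \<open>\<open>Ad_star G GM g\<close> is the dual map of \<open>Ad G GM g\<close>.\<close>

definition Ad_star ::
  "('g, 'm) monoid_scheme \<Rightarrow> ('g, 'l::real_normed_vector) manifold \<Rightarrow> 'g \<Rightarrow>
     ('l \<Rightarrow> real) \<Rightarrow> 'l \<Rightarrow> real" where
  "Ad_star G GM g \<mu> = (\<lambda>\<xi>. \<mu> (Ad G GM g \<xi>))"

definition coadjoint_isotropy ::
  "('g, 'm) monoid_scheme \<Rightarrow> ('g, 'l::real_normed_vector) manifold \<Rightarrow> ('l \<Rightarrow> real) \<Rightarrow> 'g set" where
  "coadjoint_isotropy G GM \<mu> = {g \<in> carrier G. Ad_star G GM (inv\<^bsub>G\<^esub> g) \<mu> = \<mu>}"

text \<open>\<open>HM\<close> is the Lie group structure of the (closed) subgroup \<open>H\<close> as an embedded submanifold.\<close>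

definition embedded_lie_subgroup ::
  "('g, 'm) monoid_scheme \<Rightarrow> ('g, 'l::real_normed_vector) manifold \<Rightarrow> 'g set \<Rightarrow>
     ('g, 'h::real_normed_vector) manifold \<Rightarrow> bool" where
  "embedded_lie_subgroup G GM H HM \<longleftrightarrow>
     subgroup H G \<and> lie_group (G\<lparr>carrier := H\<rparr>) HM \<and>
     smooth_map HM GM (\<lambda>g. g) \<and> (\<forall>g\<in>H. inj (tangent_map HM GM (\<lambda>g. g) g)) \<and>
     mtopology HM = subtopology (mtopology GM) H"

text \<open>The restriction of \<open>\<mu>\<close> to the Lie algebra of \<open>H\<close>, which sits in the Lie algebra of \<open>G\<close> by the
  tangent map of the inclusion.\<close>

definition restrict_dual ::
  "('g, 'm) monoid_scheme \<Rightarrow> ('g, 'l::real_normed_vector) manifold \<Rightarrow>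
     ('g, 'h::real_normed_vector) manifold \<Rightarrow> ('l \<Rightarrow> real) \<Rightarrow> 'h \<Rightarrow> real" where
  "restrict_dual G GM HM \<mu> = (\<lambda>\<xi>. \<mu> (tangent_map HM GM (\<lambda>g. g) \<one>\<^bsub>G\<^esub> \<xi>))"

definition smooth_action ::
  "('g, 'm) monoid_scheme \<Rightarrow> ('g, 'l::real_normed_vector) manifold \<Rightarrow>
     ('q, 'e::real_normed_vector) manifold \<Rightarrow> ('g \<Rightarrow> 'q \<Rightarrow> 'q) \<Rightarrow> bool" where
  "smooth_action G GM Q l \<longleftrightarrow>
     group_action G (mcarrier Q) l \<and> smooth_map (prod_manifold GM Q) Q (\<lambda>(g, q). l g q)"

definition free_action :: "('g, 'm) monoid_scheme \<Rightarrow> ('q, 'e) manifold \<Rightarrow> ('g \<Rightarrow> 'q \<Rightarrow> 'q) \<Rightarrow> bool"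
  where
  "free_action G Q l \<longleftrightarrow> (\<forall>q\<in>mcarrier Q. stabilizer G l q = {\<one>\<^bsub>G\<^esub>})"

definition proper_action ::
  "('g, 'l::real_normed_vector) manifold \<Rightarrow> ('q, 'e::real_normed_vector) manifold \<Rightarrow>
     ('g \<Rightarrow> 'q \<Rightarrow> 'q) \<Rightarrow> bool" where
  "proper_action GM Q l \<longleftrightarrow>
     proper_map (prod_topology (mtopology GM) (mtopology Q))
       (prod_topology (mtopology Q) (mtopology Q)) (\<lambda>(g, q). (q, l g q))"

text \<open>The infinitesimal generator \<open>\<xi>\<^sub>Q(q) = d/dt l\<^bsub>g(t)\<^esub>(q)\<close> at \<open>t = 0\<close>, where \<open>g\<close> is any curve through
  the unit with velocity \<open>\<xi>\<close>, such as \<open>g(t) = exp(t \<xi>)\<close>: it is the image of \<open>\<xi>\<close> under the tangent map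
  at the unit of the orbit map.\<close>

definition inf_gen ::
  "('g, 'm) monoid_scheme \<Rightarrow> ('g, 'l::real_normed_vector) manifold \<Rightarrow>
     ('q, 'e::real_normed_vector) manifold \<Rightarrow> ('g \<Rightarrow> 'q \<Rightarrow> 'q) \<Rightarrow> 'l \<Rightarrow> 'q \<Rightarrow> 'e" where
  "inf_gen G GM Q l \<xi> q = tangent_map GM Q (\<lambda>g. l g q) \<one>\<^bsub>G\<^esub> \<xi>"

text \<open>\<open>B\<close> is the manifold structure on the orbit space that makes the projection to it a principal
  bundle; its points are the orbits.\<close>

definition quotient_principal_bundle ::
  "('g, 'm) monoid_scheme \<Rightarrow> ('g, 'l::real_normed_vector) manifold \<Rightarrow>
     ('q, 'e::real_normed_vector) manifold \<Rightarrow> ('g \<Rightarrow> 'q \<Rightarrow> 'q) \<Rightarrow>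
     ('q set, 'b::real_normed_vector) manifold \<Rightarrow> bool" where
  "quotient_principal_bundle G GM Q l B \<longleftrightarrow>
     smooth_manifold B \<and> mcarrier B = orbits G (mcarrier Q) l \<and>
     smooth_map Q B (orbit G l) \<and>
     (\<forall>\<tau>\<in>mcarrier B. \<exists>U \<Psi>. openin (mtopology B) U \<and> \<tau> \<in> U \<and>
        diffeomorphism (open_submanifold Q {q\<in>mcarrier Q. orbit G l q \<in> U})
          (prod_manifold (open_submanifold B U) GM) \<Psi> \<and>
        (\<forall>q\<in>mcarrier Q. orbit G l q \<in> U \<longrightarrow>
           fst (\<Psi> q) = orbit G l q \<and>
           (\<forall>g\<in>carrier G. snd (\<Psi> (l g q)) = g \<otimes>\<^bsub>G\<^esub> snd (\<Psi> q))))"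

definition principal_connection ::
  "('g, 'm) monoid_scheme \<Rightarrow> ('g, 'l::real_normed_vector) manifold \<Rightarrow>
     ('q, 'e::real_normed_vector) manifold \<Rightarrow> ('g \<Rightarrow> 'q \<Rightarrow> 'q) \<Rightarrow> ('q \<Rightarrow> 'e \<Rightarrow> 'l) \<Rightarrow> bool" where
  "principal_connection G GM Q l \<AA> \<longleftrightarrow>
     (\<forall>q\<in>mcarrier Q. linear (\<AA> q)) \<and>
     smooth_map (tangent_bundle Q) vec_manifold (\<lambda>(q, v). \<AA> q v) \<and>
     (\<forall>q\<in>mcarrier Q. \<forall>\<xi>. \<AA> q (inf_gen G GM Q l \<xi> q) = \<xi>) \<and>
     (\<forall>g\<in>carrier G. \<forall>q\<in>mcarrier Q. \<forall>v.
        \<AA> (l g q) (tangent_map Q Q (l g) q v) = Ad G GM g (\<AA> q v))"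

definition horizontal_lift ::
  "('g, 'm) monoid_scheme \<Rightarrow> ('q, 'e::real_normed_vector) manifold \<Rightarrow> ('g \<Rightarrow> 'q \<Rightarrow> 'q) \<Rightarrow>
     ('q set, 'b::real_normed_vector) manifold \<Rightarrow> ('q \<Rightarrow> 'e \<Rightarrow> 'l::real_normed_vector) \<Rightarrow>
     'q \<Rightarrow> 'b \<Rightarrow> 'e" where
  "horizontal_lift G Q l B \<AA> q w =
     (THE v. \<AA> q v = 0 \<and> tangent_map Q B (orbit G l) q v = w)"


section \<open>Discrete mechanical systems with symmetry\<close>

definition discrete_legendre_plus ::
  "('q, 'e::real_normed_vector) manifold \<Rightarrow> ('q \<times> 'q \<Rightarrow> real) \<Rightarrow> 'q \<times> 'q \<Rightarrow> 'q \<times> ('e \<Rightarrow>\<^sub>L real)"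
  where
  "discrete_legendre_plus Q Ld = (\<lambda>(q0, q1). (q1, Blinfun (D2 Q Ld q0 q1)))"

definition discrete_legendre_minus ::
  "('q, 'e::real_normed_vector) manifold \<Rightarrow> ('q \<times> 'q \<Rightarrow> real) \<Rightarrow> 'q \<times> 'q \<Rightarrow> 'q \<times> ('e \<Rightarrow>\<^sub>L real)"
  where
  "discrete_legendre_minus Q Ld = (\<lambda>(q0, q1). (q0, - Blinfun (D1 Q Ld q0 q1)))"

definition regular_lagrangian ::
  "('q, 'e::real_normed_vector) manifold \<Rightarrow> ('q \<times> 'q \<Rightarrow> real) \<Rightarrow> bool" where
  "regular_lagrangian Q Ld \<longleftrightarrow>
     local_diffeomorphism (prod_manifold Q Q) (cotangent_bundle Q) (discrete_legendre_plus Q Ld) \<and>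
     local_diffeomorphism (prod_manifold Q Q) (cotangent_bundle Q) (discrete_legendre_minus Q Ld)"

definition invariant_lagrangian ::
  "('g, 'm) monoid_scheme \<Rightarrow> ('q, 'e) manifold \<Rightarrow> ('g \<Rightarrow> 'q \<Rightarrow> 'q) \<Rightarrow> ('q \<times> 'q \<Rightarrow> real) \<Rightarrow> bool"
  where
  "invariant_lagrangian G Q l Ld \<longleftrightarrow>
     (\<forall>g\<in>carrier G. \<forall>q0\<in>mcarrier Q. \<forall>q1\<in>mcarrier Q. Ld (l g q0, l g q1) = Ld (q0, q1))"

definition D2D1 ::
  "('q, 'e::real_normed_vector) manifold \<Rightarrow> ('q \<times> 'q \<Rightarrow> real) \<Rightarrow> 'q \<Rightarrow> 'q \<Rightarrow> 'e \<Rightarrow> 'e \<Rightarrow> real" where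
  "D2D1 Q Ld q0 q1 v w = D2 Q (\<lambda>(x, y). D1 Q Ld x y v) q0 q1 w"

definition nondegenerate_on ::
  "'a::zero set \<Rightarrow> 'b::zero set \<Rightarrow> ('a \<Rightarrow> 'b \<Rightarrow> real) \<Rightarrow> bool" where
  "nondegenerate_on V W b \<longleftrightarrow>
     (\<forall>v\<in>V. (\<forall>w\<in>W. b v w = 0) \<longrightarrow> v = 0) \<and> (\<forall>w\<in>W. (\<forall>v\<in>V. b v w = 0) \<longrightarrow> w = 0)"

text \<open>In the remaining definitions \<open>(K, KM)\<close> is the isotropy group \<open>G\<^sub>\<mu>\<close> with its Lie group structure,
  \<open>\<nu>\<close> the restriction of \<open>\<mu>\<close> to its Lie algebra, \<open>l\<close> the action, \<open>B\<close> the quotient manifold \<open>Q/G\<^sub>\<mu>\<close>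
  and \<open>\<AA>\<close> the principal connection.\<close>

definition momentum_map ::
  "('g, 'm) monoid_scheme \<Rightarrow> ('g, 'h::real_normed_vector) manifold \<Rightarrow>
     ('q, 'e::real_normed_vector) manifold \<Rightarrow> ('g \<Rightarrow> 'q \<Rightarrow> 'q) \<Rightarrow> ('q \<times> 'q \<Rightarrow> real) \<Rightarrow>
     'q \<Rightarrow> 'q \<Rightarrow> 'h \<Rightarrow> real" where
  "momentum_map K KM Q l Ld q0 q1 = (\<lambda>\<xi>. - D1 Q Ld q0 q1 (inf_gen K KM Q l \<xi> q0))"

definition momentum_level ::
  "('g, 'm) monoid_scheme \<Rightarrow> ('g, 'h::real_normed_vector) manifold \<Rightarrow>
     ('q, 'e::real_normed_vector) manifold \<Rightarrow> ('g \<Rightarrow> 'q \<Rightarrow> 'q) \<Rightarrow> ('q \<times> 'q \<Rightarrow> real) \<Rightarrow>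
     ('h \<Rightarrow> real) \<Rightarrow> ('q \<times> 'q) set" where
  "momentum_level K KM Q l Ld \<nu> =
     {(q0, q1). q0 \<in> mcarrier Q \<and> q1 \<in> mcarrier Q \<and> momentum_map K KM Q l Ld q0 q1 = \<nu>}"

definition good_symmetries ::
  "('g, 'm) monoid_scheme \<Rightarrow> ('g, 'h::real_normed_vector) manifold \<Rightarrow>
     ('q, 'e::real_normed_vector) manifold \<Rightarrow> ('g \<Rightarrow> 'q \<Rightarrow> 'q) \<Rightarrow> ('q \<times> 'q \<Rightarrow> real) \<Rightarrow>
     ('h \<Rightarrow> real) \<Rightarrow> bool" where
  "good_symmetries K KM Q l Ld \<nu> \<longleftrightarrow>
     regular_lagrangian Q Ld \<and>
     (\<forall>q0\<in>mcarrier Q. \<forall>q1\<in>mcarrier Q.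
        nondegenerate_on
          (tangent_space_sub Q (orbit K l q0) q0) (tangent_space_sub Q (orbit K l q1) q1)
          (D2D1 Q Ld q0 q1)) \<and>
     (\<forall>q\<in>mcarrier Q. \<exists>!g. g \<in> carrier K \<and> momentum_map K KM Q l Ld q (l g q) = \<nu>)"

definition discrete_connection ::
  "('g, 'm) monoid_scheme \<Rightarrow> ('g, 'h::real_normed_vector) manifold \<Rightarrow>
     ('q, 'e::real_normed_vector) manifold \<Rightarrow> ('g \<Rightarrow> 'q \<Rightarrow> 'q) \<Rightarrow> ('q \<times> 'q \<Rightarrow> real) \<Rightarrow>
     ('h \<Rightarrow> real) \<Rightarrow> 'q \<times> 'q \<Rightarrow> 'g" where
  "discrete_connection K KM Q l Ld \<nu> = (\<lambda>(q0, q1).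
     THE g. g \<in> carrier K \<and> momentum_map K KM Q l Ld q0 (l (inv\<^bsub>K\<^esub> g) q1) = \<nu>)"

definition has_affine_discrete_connection ::
  "('g, 'm) monoid_scheme \<Rightarrow> ('g, 'h::real_normed_vector) manifold \<Rightarrow>
     ('q, 'e::real_normed_vector) manifold \<Rightarrow> ('g \<Rightarrow> 'q \<Rightarrow> 'q) \<Rightarrow> ('q \<times> 'q \<Rightarrow> real) \<Rightarrow>
     ('h \<Rightarrow> real) \<Rightarrow> bool" where
  "has_affine_discrete_connection K KM Q l Ld \<nu> \<longleftrightarrow>
     (\<forall>q0\<in>mcarrier Q. \<forall>q1\<in>mcarrier Q.
        \<exists>!g. g \<in> carrier K \<and> momentum_map K KM Q l Ld q0 (l (inv\<^bsub>K\<^esub> g) q1) = \<nu>) \<and>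
     smooth_map (prod_manifold Q Q) KM (discrete_connection K KM Q l Ld \<nu>)"

definition discrete_horizontal_lift ::
  "('g, 'm) monoid_scheme \<Rightarrow> ('g, 'h::real_normed_vector) manifold \<Rightarrow>
     ('q, 'e::real_normed_vector) manifold \<Rightarrow> ('g \<Rightarrow> 'q \<Rightarrow> 'q) \<Rightarrow> ('q \<times> 'q \<Rightarrow> real) \<Rightarrow>
     ('h \<Rightarrow> real) \<Rightarrow> 'q \<Rightarrow> 'q set \<Rightarrow> 'q" where
  "discrete_horizontal_lift K KM Q l Ld \<nu> q0 \<tau>1 =
     (THE q1. q1 \<in> mcarrier Q \<and> orbit K l q1 = \<tau>1 \<and> momentum_map K KM Q l Ld q0 q1 = \<nu>)"

definition L_check ::
  "('g, 'm) monoid_scheme \<Rightarrow> ('g, 'h::real_normed_vector) manifold \<Rightarrow>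
     ('q, 'e::real_normed_vector) manifold \<Rightarrow> ('g \<Rightarrow> 'q \<Rightarrow> 'q) \<Rightarrow> ('q \<times> 'q \<Rightarrow> real) \<Rightarrow>
     ('h \<Rightarrow> real) \<Rightarrow> 'q \<Rightarrow> 'g \<Rightarrow> 'q set \<Rightarrow> real" where
  "L_check K KM Q l Ld \<nu> q0 w \<tau>1 =
     Ld (q0, l w (discrete_horizontal_lift K KM Q l Ld \<nu> q0 \<tau>1))"

text \<open>The force, expressed with a representative \<open>q0\<close> of \<open>\<tau>0\<close>. The discrete connection has the
  value \<open>\<one>\<^bsub>K\<^esub>\<close> at \<open>(q0, q1)\<close>, so its tangent map there takes values in the Lie algebra of \<open>K\<close>.\<close>

definition f_breve_at ::
  "('g, 'm) monoid_scheme \<Rightarrow> ('g, 'h::real_normed_vector) manifold \<Rightarrow>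
     ('q, 'e::real_normed_vector) manifold \<Rightarrow> ('g \<Rightarrow> 'q \<Rightarrow> 'q) \<Rightarrow> ('q \<times> 'q \<Rightarrow> real) \<Rightarrow>
     ('h \<Rightarrow> real) \<Rightarrow> ('q set, 'b::real_normed_vector) manifold \<Rightarrow> ('q \<Rightarrow> 'e \<Rightarrow> 'h) \<Rightarrow>
     'q \<Rightarrow> 'q set \<Rightarrow> 'b \<times> 'b \<Rightarrow> real" where
  "f_breve_at K KM Q l Ld \<nu> B \<AA> q0 \<tau>1 = (\<lambda>(\<delta>\<tau>0, \<delta>\<tau>1).
     let q1 = discrete_horizontal_lift K KM Q l Ld \<nu> q0 \<tau>1 in
       tangent_map KM vec_manifold (\<lambda>w. L_check K KM Q l Ld \<nu> q0 w \<tau>1) \<one>\<^bsub>K\<^esub>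
         (tangent_map (prod_manifold Q Q) KM (discrete_connection K KM Q l Ld \<nu>) (q0, q1)
            (horizontal_lift K Q l B \<AA> q0 \<delta>\<tau>0, horizontal_lift K Q l B \<AA> q1 \<delta>\<tau>1)))"

text \<open>The description operator makes the definition independent of the choice of \<open>q0\<close>.\<close>

definition f_breve ::
  "('g, 'm) monoid_scheme \<Rightarrow> ('g, 'h::real_normed_vector) manifold \<Rightarrow>
     ('q, 'e::real_normed_vector) manifold \<Rightarrow> ('g \<Rightarrow> 'q \<Rightarrow> 'q) \<Rightarrow> ('q \<times> 'q \<Rightarrow> real) \<Rightarrow>
     ('h \<Rightarrow> real) \<Rightarrow> ('q set, 'b::real_normed_vector) manifold \<Rightarrow> ('q \<Rightarrow> 'e \<Rightarrow> 'h) \<Rightarrow>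
     'q set \<times> 'q set \<Rightarrow> 'b \<times> 'b \<Rightarrow> real" where
  "f_breve K KM Q l Ld \<nu> B \<AA> = (\<lambda>(\<tau>0, \<tau>1).
     THE \<alpha>. \<forall>q0\<in>mcarrier Q. orbit K l q0 = \<tau>0 \<longrightarrow> \<alpha> = f_breve_at K KM Q l Ld \<nu> B \<AA> q0 \<tau>1)"

definition connection_form :: "('h \<Rightarrow> real) \<Rightarrow> ('q \<Rightarrow> 'e \<Rightarrow> 'h) \<Rightarrow> 'q \<Rightarrow> 'e \<Rightarrow> real" where
  "connection_form \<nu> \<AA> q v = \<nu> (\<AA> q v)"

definition A_script ::
  "('q, 'e::real_normed_vector) manifold \<Rightarrow> ('h \<Rightarrow> real) \<Rightarrow> ('q \<Rightarrow> 'e \<Rightarrow> 'h) \<Rightarrow>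
     'q \<times> 'q \<Rightarrow> 'e \<times> 'e \<Rightarrow> real" where
  "A_script Q \<nu> \<AA> p v =
     pullback_form (prod_manifold Q Q) Q snd (connection_form \<nu> \<AA>) p v -
     pullback_form (prod_manifold Q Q) Q fst (connection_form \<nu> \<AA>) p v"

text \<open>The 1-form on \<open>Q/G\<^sub>\<mu> \<times> Q/G\<^sub>\<mu>\<close> to which the restriction of \<open>A_script\<close> to the momentum level set
  drops, described pointwise as the unique covector with the defining property.\<close>

definition A_breve ::
  "('g, 'm) monoid_scheme \<Rightarrow> ('g, 'h::real_normed_vector) manifold \<Rightarrow>
     ('q, 'e::real_normed_vector) manifold \<Rightarrow> ('g \<Rightarrow> 'q \<Rightarrow> 'q) \<Rightarrow> ('q \<times> 'q \<Rightarrow> real) \<Rightarrow>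
     ('h \<Rightarrow> real) \<Rightarrow> ('q set, 'b::real_normed_vector) manifold \<Rightarrow> ('q \<Rightarrow> 'e \<Rightarrow> 'h) \<Rightarrow>
     'q set \<times> 'q set \<Rightarrow> 'b \<times> 'b \<Rightarrow> real" where
  "A_breve K KM Q l Ld \<nu> B \<AA> = (\<lambda>(\<tau>0, \<tau>1).
     THE \<alpha>. linear \<alpha> \<and>
       (\<forall>(q0, q1)\<in>momentum_level K KM Q l Ld \<nu>. orbit K l q0 = \<tau>0 \<longrightarrow> orbit K l q1 = \<tau>1 \<longrightarrow>
          (\<forall>(\<delta>q0, \<delta>q1)\<in>
              tangent_space_sub (prod_manifold Q Q) (momentum_level K KM Q l Ld \<nu>) (q0, q1).
             \<alpha> (tangent_map Q B (orbit K l) q0 \<delta>q0, tangent_map Q B (orbit K l) q1 \<delta>q1)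
               = A_script Q \<nu> \<AA> (q0, q1) (\<delta>q0, \<delta>q1))))"

end

theory Submission
  imports Defs
begin

text \<open>
  Let \<open>A\<close> be the affine discrete connection and let \<open>J (q0, q1) = \<nu>\<close>, so that \<open>A (q0, q1) = \<one>\<close>. The
  derivative of \<open>w \<mapsto> Ld (q0, w q1)\<close> at the unit is the momentum, that is, \<open>\<nu>\<close>. Hence the force is \<open>\<nu>\<close>
  applied to \<open>TA (u0, u1)\<close>, where \<open>u0\<close> and \<open>u1\<close> are the horizontal lifts of the two base vectors
  (\<open>force_eq\<close>).

  The equivariance \<open>A (g0 q0, g1 q1) = g1 A (q0, q1) inv g0\<close> shows that \<open>TA\<close> maps the vertical vector
  with generators \<open>\<xi>0\<close>, \<open>\<xi>1\<close> to \<open>\<xi>1 - \<xi>0\<close> (\<open>TA_vertical\<close>). On the other hand \<open>A\<close> is constant on the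
  level set of \<open>\<nu>\<close>, so \<open>TA\<close> vanishes on vectors \<open>(v0, v1)\<close> tangent to it (\<open>TA_level\<close>). Writing
  \<open>v0\<close>, \<open>v1\<close> as a horizontal part plus the generators of \<open>\<xi>0 = \<AA> v0\<close> and \<open>\<xi>1 = \<AA> v1\<close> gives
  \<open>0 = TA (u0, u1) + \<xi>1 - \<xi>0\<close>. Applying \<open>\<nu>\<close>, the force at the projections of \<open>v0\<close>, \<open>v1\<close> is
  \<open>- (\<nu> (\<AA> v1) - \<nu> (\<AA> v0))\<close>, which is the claim along the level (\<open>force_on_level\<close>).

  Two points remain because both 1-forms live on the quotient. The force must not depend on the
  representative \<open>q0\<close>; this is equivariance of all data together with the invariance of \<open>\<mu>\<close> under its
  isotropy group (\<open>force_invariant\<close>). And vectors tangent to the level must project onto all of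
  \<open>T(Q/K) \<times> T(Q/K)\<close>; they do because any pair of curves can be moved into the level along the fibres by
  means of \<open>A\<close> (\<open>level_tangent_surj\<close>). That last curve has to be smooth to every order, which rests on a
  chain rule for \<open>C\<^sup>k\<close> maps between finite-dimensional normed spaces (\<open>Ck_on_compose\<close>).
\<close>


section \<open>Calculus in finite-dimensional normed spaces\<close>

text \<open>Coordinates on a finite-dimensional space are continuous. This is an induction on the basis:
  a vector \<open>a\<close> outside the closed subspace \<open>span B\<close> has positive distance \<open>d\<close> from it, so the
  \<open>a\<close>-coordinate of \<open>v\<close> is at most \<open>norm v / d\<close>; the same bound makes the \<open>a\<close>-coordinates of a
  convergent sequence converge, so the larger span is closed again.\<close>

lemma finite_independent_coordinates_bounded:
  fixes B :: "'a::real_normed_vector set"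
  assumes "finite B" "independent B"
  shows "closed (span B) \<and> (\<exists>K\<ge>0. \<forall>u. \<forall>b\<in>B. \<bar>u b\<bar> \<le> K * norm (\<Sum>b\<in>B. u b *\<^sub>R b))"
  using assms
proof (induction B rule: finite_induct)
  case empty
  show ?case by auto
next
  case (insert a B)
  have ind: "independent B" and a: "a \<notin> span B"
    using insert.prems insert.hyps by (auto simp: independent_insert)
  obtain K where cl: "closed (span B)" and K: "K \<ge> 0"
      "\<And>u b. b \<in> B \<Longrightarrow> \<bar>u b\<bar> \<le> K * norm (\<Sum>b\<in>B. u b *\<^sub>R b)"
    using insert.IH[OF ind] by blast
  define d where "d = infdist a (span B)"
  have d: "d > 0"
    unfolding d_def by (rule infdist_pos_not_in_closed[OF cl _ a]) (use span_zero in blast)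
  have dle: "\<bar>t\<bar> * d \<le> norm (t *\<^sub>R a + s)" if s: "s \<in> span B" for t s
  proof (cases "t = 0")
    case False
    have "- (s /\<^sub>R t) \<in> span B" using s by (intro span_neg span_scale)
    then have "d \<le> dist a (- (s /\<^sub>R t))" unfolding d_def by (rule infdist_le)
    then have "\<bar>t\<bar> * d \<le> \<bar>t\<bar> * norm (a + s /\<^sub>R t)"
      by (simp add: dist_norm mult_left_mono)
    also have "\<dots> = norm (t *\<^sub>R (a + s /\<^sub>R t))" by simp
    also have "t *\<^sub>R (a + s /\<^sub>R t) = t *\<^sub>R a + s" using False by (simp add: scaleR_add_right)
    finally show ?thesis .
  qed simp
  have "closed (span (insert a B))"
    unfolding closed_sequential_limits
  proof (intro allI impI, elim conjE)
    fix x v assume x: "\<forall>n. x n \<in> span (insert a B)" and lim: "x \<longlonglongrightarrow> v"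
    have "\<forall>n. \<exists>k. x n - k *\<^sub>R a \<in> span B" using x by (simp add: span_breakdown_eq)
    then obtain t where t: "\<And>n. x n - t n *\<^sub>R a \<in> span B" by metis
    have bd: "\<bar>t m - t n\<bar> * d \<le> norm (x m - x n)" for m n
      using dle[OF span_diff[OF t[of m] t[of n]], of "t m - t n"]
      by (simp add: scaleR_diff_left algebra_simps)
    have "Cauchy t"
    proof (rule CauchyI)
      fix e :: real assume "0 < e"
      then have "0 < e * d" using d by simp
      moreover have "Cauchy x" using lim by (rule LIMSEQ_imp_Cauchy)
      ultimately obtain M where M: "\<And>m n. m \<ge> M \<Longrightarrow> n \<ge> M \<Longrightarrow> norm (x m - x n) < e * d"
        using CauchyD by blast
      have "norm (t m - t n) < e" if "m \<ge> M" "n \<ge> M" for m n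
      proof -
        have "\<bar>t m - t n\<bar> * d < e * d" using bd[of m n] M[OF that] by linarith
        then show ?thesis using d by simp
      qed
      then show "\<exists>M. \<forall>m\<ge>M. \<forall>n\<ge>M. norm (t m - t n) < e" by blast
    qed
    then obtain t0 where "t \<longlonglongrightarrow> t0" using Cauchy_convergent convergent_def by blast
    then have "(\<lambda>n. x n - t n *\<^sub>R a) \<longlonglongrightarrow> v - t0 *\<^sub>R a"
      using lim by (intro tendsto_intros)
    then have "v - t0 *\<^sub>R a \<in> span B"
      by (rule closed_sequentially[OF cl t])
    then show "v \<in> span (insert a B)" by (auto simp: span_breakdown_eq)
  qed
  moreover have "\<exists>K\<ge>0. \<forall>u. \<forall>b\<in>insert a B. \<bar>u b\<bar> \<le> K * norm (\<Sum>b\<in>insert a B. u b *\<^sub>R b)"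
  proof -
    define K' where "K' = 1 / d + K * (1 + norm a / d)"
    have le: "\<bar>u b\<bar> \<le> K' * norm (\<Sum>b\<in>insert a B. u b *\<^sub>R b)" if b: "b \<in> insert a B" for u b
    proof -
      define s where "s = (\<Sum>b\<in>B. u b *\<^sub>R b)"
      define v where "v = (\<Sum>b\<in>insert a B. u b *\<^sub>R b)"
      have v: "v = u a *\<^sub>R a + s" unfolding v_def s_def using insert.hyps by simp
      have "s \<in> span B" unfolding s_def by (intro span_sum span_scale span_base)
      then have 1: "\<bar>u a\<bar> * d \<le> norm v" unfolding v by (rule dle)
      then have ua: "\<bar>u a\<bar> \<le> norm v / d" using d by (simp add: field_simps)
      have "norm s \<le> norm v + \<bar>u a\<bar> * norm a"
        using norm_triangle_ineq4[of v "u a *\<^sub>R a"] by (simp add: v)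
      also have "\<dots> \<le> norm v + norm v / d * norm a"
        using ua by (intro add_left_mono mult_right_mono) auto
      finally have ns: "norm s \<le> (1 + norm a / d) * norm v" by (simp add: algebra_simps)
      have p: "0 \<le> norm v / d" "0 \<le> K * ((1 + norm a / d) * norm v)"
        using d K(1) by simp_all
      have K'v: "K' * norm v = norm v / d + K * ((1 + norm a / d) * norm v)"
        unfolding K'_def by (simp add: algebra_simps)
      have "\<bar>u b\<bar> \<le> K' * norm v"
      proof (cases "b = a")
        case True
        then show ?thesis using ua p K'v by simp
      next
        case False
        then have "\<bar>u b\<bar> \<le> K * norm s" using K(2)[of b u] b unfolding s_def by simp
        also have "\<dots> \<le> K * ((1 + norm a / d) * norm v)" using ns K(1) by (rule mult_left_mono)
        finally show ?thesis using p K'v by simp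
      qed
      then show ?thesis unfolding v_def .
    qed
    have "K' \<ge> 0" unfolding K'_def using d K(1) by simp
    then show ?thesis using le by blast
  qed
  ultimately show ?case by blast
qed

lemma finite_dimensional_coordinates:
  assumes "finite_dimensional TYPE('a::real_normed_vector)"
  obtains B :: "'a::real_normed_vector set" and c :: "'a \<Rightarrow> 'a \<Rightarrow> real"
  where "finite B" "\<And>b. bounded_linear (c b)" "\<And>x. x = (\<Sum>b\<in>B. c b x *\<^sub>R b)"
proof -
  obtain B0 :: "'a set" where B0: "finite B0" "span B0 = UNIV"
    using assms by (auto simp: finite_dimensional_def)
  obtain B where B: "B \<subseteq> B0" "independent B" "B0 \<subseteq> span B"
    using maximal_independent_subset by blast
  have fin: "finite B" using B(1) B0(1) by (rule finite_subset)
  have sp: "span B = UNIV"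
    using B0(2) B(3) by (metis span_mono span_span top.extremum_uniqueI)
  obtain K where K: "K \<ge> 0" "\<And>u b. b \<in> B \<Longrightarrow> \<bar>u b\<bar> \<le> K * norm (\<Sum>b\<in>B. u b *\<^sub>R b)"
    using finite_independent_coordinates_bounded[OF fin B(2)] by blast
  have sum: "(\<Sum>b\<in>B. representation B x b *\<^sub>R b) = x" for x
    using B(2) fin sp by (intro sum_representation_eq) auto
  have "bounded_linear (\<lambda>x. representation B x b)" for b
  proof (cases "b \<in> B")
    case True
    show ?thesis
      by (rule bounded_linear_intro[where K = K])
        (use B(2) sp K(2)[OF True, of "representation B x" for x] in
          \<open>auto simp: representation_add representation_scale sum mult.commute\<close>)
  next
    case False
    then have "(\<lambda>x. representation B x b) = (\<lambda>x. 0)"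
      using representation_ne_zero by blast
    then show ?thesis by simp
  qed
  then show thesis using that[of B "\<lambda>b x. representation B x b"] fin sum by simp
qed

lemma finite_dimensional_prod:
  assumes "finite_dimensional TYPE('a::real_normed_vector)"
    and "finite_dimensional TYPE('b::real_normed_vector)"
  shows "finite_dimensional TYPE('a \<times> 'b)"
proof -
  obtain A :: "'a set" and C :: "'b set"
    where A: "finite A" "span A = UNIV" and C: "finite C" "span C = UNIV"
    using assms by (auto simp: finite_dimensional_def)
  have "(x, y) \<in> span (A \<times> {0} \<union> {0} \<times> C)" for x y
  proof -
    have lin: "linear (\<lambda>x::'a. (x, 0::'b))" "linear (\<lambda>y::'b. (0::'a, y))"
      by (auto intro!: linearI)
    have "(x, 0) \<in> span (A \<times> {0} \<union> {0} \<times> C)"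
    proof -
      have "(\<lambda>x. (x, 0)) ` span A = span ((\<lambda>x. (x, 0::'b)) ` A)" by (rule linear_span_image[OF lin(1), symmetric])
      then have "(x, 0) \<in> span ((\<lambda>x. (x, 0::'b)) ` A)" using A(2) by auto
      then show ?thesis by (rule rev_subsetD) (intro span_mono, auto)
    qed
    moreover have "(0, y) \<in> span (A \<times> {0} \<union> {0} \<times> C)"
    proof -
      have "(\<lambda>y. (0, y)) ` span C = span ((\<lambda>y. (0::'a, y)) ` C)" by (rule linear_span_image[OF lin(2), symmetric])
      then have "(0, y) \<in> span ((\<lambda>y. (0::'a, y)) ` C)" using C(2) by auto
      then show ?thesis by (rule rev_subsetD) (intro span_mono, auto)
    qed
    ultimately have "(x, 0) + (0, y) \<in> span (A \<times> {0} \<union> {0} \<times> C)" by (rule span_add)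
    then show ?thesis by simp
  qed
  then have "span (A \<times> {0} \<union> {0} \<times> C) = UNIV" by auto
  then show ?thesis
    unfolding finite_dimensional_def using A(1) C(1) by (metis finite.emptyI finite_SigmaI finite_UnI finite_insert)
qed

lemma Ck_on_cong:
  assumes S: "open S" and "\<And>x. x \<in> S \<Longrightarrow> f x = g x" "Ck_on k S f"
  shows "Ck_on k S g"
  using assms(2,3)
proof (induction k arbitrary: f g)
  case 0
  then show ?case using continuous_on_cong[OF refl, of S f g] by simp
next
  case (Suc k)
  have der: "(g has_derivative frechet_derivative f (at x)) (at x)" if x: "x \<in> S" for x
  proof (rule has_derivative_transform_within_open[OF _ S x])
    show "(f has_derivative frechet_derivative f (at x)) (at x)"
      using Suc.prems(2) x by (simp add: frechet_derivative_works)
  qed (use Suc.prems(1) in auto)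
  have "Ck_on k S (\<lambda>x. frechet_derivative g (at x) v)" for v
  proof (rule Suc.IH)
    show "frechet_derivative f (at x) v = frechet_derivative g (at x) v" if "x \<in> S" for x
      using frechet_derivative_at[OF der[OF that]] by simp
    show "Ck_on k S (\<lambda>x. frechet_derivative f (at x) v)" using Suc.prems by simp
  qed
  then show ?case using der by (auto simp: differentiable_def)
qed

lemma Ck_on_SucI:
  assumes "open S" "\<And>x. x \<in> S \<Longrightarrow> (f has_derivative D x) (at x)"
    and "\<And>v. Ck_on k S (\<lambda>x. D x v)"
  shows "Ck_on (Suc k) S f"
proof -
  have "Ck_on k S (\<lambda>x. frechet_derivative f (at x) v)" for v
  proof (rule Ck_on_cong[OF assms(1) _ assms(3)[of v]])
    show "D x v = frechet_derivative f (at x) v" if "x \<in> S" for x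
      using frechet_derivative_at[OF assms(2)[OF that]] by simp
  qed
  then show ?thesis using assms(2) by (auto simp: differentiable_def)
qed

lemma Ck_on_SucD:
  assumes "Ck_on (Suc k) S f" "x \<in> S"
  shows "(f has_derivative frechet_derivative f (at x)) (at x)"
  using assms by (simp add: frechet_derivative_works)

lemma Ck_on_mono: "Ck_on (Suc k) S f \<Longrightarrow> Ck_on k S f"
proof (induction k arbitrary: f)
  case 0
  then show ?case
    by (auto intro!: continuous_at_imp_continuous_on differentiable_imp_continuous_within)
next
  case (Suc k)
  have "Ck_on k S (\<lambda>x. frechet_derivative f (at x) v)" for v
    using Suc.prems by (intro Suc.IH) simp
  then show ?case using Suc.prems by simp
qed

lemma Ck_on_subset: "Ck_on k S f \<Longrightarrow> T \<subseteq> S \<Longrightarrow> Ck_on k T f"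
  by (induction k arbitrary: f) (auto intro: continuous_on_subset)

lemma Ck_on_local:
  assumes "\<And>x. x \<in> S \<Longrightarrow> \<exists>T. open T \<and> x \<in> T \<and> Ck_on k T f"
  shows "Ck_on k S f"
  using assms
proof (induction k arbitrary: f)
  case 0
  have "isCont f x" if x: "x \<in> S" for x
  proof -
    obtain T where "open T" "x \<in> T" "continuous_on T f" using "0.prems"[OF x] by auto
    then show ?thesis by (simp add: continuous_on_eq_continuous_at)
  qed
  then show ?case by (auto intro: continuous_at_imp_continuous_on)
next
  case (Suc k)
  have "Ck_on k S (\<lambda>x. frechet_derivative f (at x) v)" for v
    by (rule Suc.IH) (use Suc.prems in fastforce)
  then show ?case using Suc.prems by fastforce
qed

lemma Ck_on_const: "Ck_on k S (\<lambda>x. c)"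
  by (induction k arbitrary: c) auto

lemma Ck_on_bounded_linear:
  assumes "bounded_linear L" "open S" "Ck_on k S f"
  shows "Ck_on k S (\<lambda>x. L (f x))"
  using assms(3)
proof (induction k arbitrary: f)
  case 0
  then show ?case using assms(1) by (simp add: bounded_linear.continuous_on)
next
  case (Suc k)
  show ?case
  proof (rule Ck_on_SucI[OF assms(2)])
    show "((\<lambda>x. L (f x)) has_derivative (\<lambda>v. L (frechet_derivative f (at x) v))) (at x)"
      if "x \<in> S" for x
      using bounded_linear.has_derivative[OF assms(1) Ck_on_SucD[OF Suc.prems that]] .
    show "Ck_on k S (\<lambda>x. L (frechet_derivative f (at x) v))" for v
      using Suc.prems by (intro Suc.IH) simp
  qed
qed

lemma Ck_on_id: "open S \<Longrightarrow> Ck_on k S (\<lambda>x. x)"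
  by (cases k) (auto intro!: Ck_on_SucI Ck_on_const)

lemma Ck_on_add:
  assumes "open S" "Ck_on k S f" "Ck_on k S g"
  shows "Ck_on k S (\<lambda>x. f x + g x)"
  using assms(2,3)
proof (induction k arbitrary: f g)
  case 0
  then show ?case by (simp add: continuous_on_add)
next
  case (Suc k)
  show ?case
  proof (rule Ck_on_SucI[OF assms(1)])
    show "((\<lambda>x. f x + g x) has_derivative
        (\<lambda>v. frechet_derivative f (at x) v + frechet_derivative g (at x) v)) (at x)"
      if "x \<in> S" for x
      using Ck_on_SucD[OF Suc.prems(1) that] Ck_on_SucD[OF Suc.prems(2) that]
      by (rule has_derivative_add)
  qed (use Suc in auto)
qed

lemma Ck_on_sum:
  assumes "open S" "finite B" "\<And>b. b \<in> B \<Longrightarrow> Ck_on k S (f b)"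
  shows "Ck_on k S (\<lambda>x. \<Sum>b\<in>B. f b x)"
  using assms(2,3) by (induction B rule: finite_induct) (auto intro: Ck_on_const Ck_on_add assms(1))

lemma Ck_on_scaleR:
  assumes "open S" "Ck_on k S a" "Ck_on k S g"
  shows "Ck_on k S (\<lambda>x. a x *\<^sub>R g x)"
  using assms(2,3)
proof (induction k arbitrary: a g)
  case 0
  then show ?case by (simp add: continuous_on_scaleR)
next
  case (Suc k)
  show ?case
  proof (rule Ck_on_SucI[OF assms(1)])
    show "((\<lambda>x. a x *\<^sub>R g x) has_derivative
        (\<lambda>v. a x *\<^sub>R frechet_derivative g (at x) v + frechet_derivative a (at x) v *\<^sub>R g x)) (at x)"
      if "x \<in> S" for x
      using Ck_on_SucD[OF Suc.prems(1) that] Ck_on_SucD[OF Suc.prems(2) that]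
      by (rule has_derivative_scaleR)
    show "Ck_on k S (\<lambda>x. a x *\<^sub>R frechet_derivative g (at x) v +
        frechet_derivative a (at x) v *\<^sub>R g x)" for v
      using Suc.prems Suc.prems(1,2)[THEN Ck_on_mono] by (intro Ck_on_add[OF assms(1)] Suc.IH) auto
  qed
qed

lemma Ck_on_Pair:
  assumes "open S" "Ck_on k S f" "Ck_on k S g"
  shows "Ck_on k S (\<lambda>x. (f x, g x))"
  using assms(2,3)
proof (induction k arbitrary: f g)
  case 0
  then show ?case by (simp add: continuous_on_Pair)
next
  case (Suc k)
  show ?case
  proof (rule Ck_on_SucI[OF assms(1)])
    show "((\<lambda>x. (f x, g x)) has_derivative
        (\<lambda>v. (frechet_derivative f (at x) v, frechet_derivative g (at x) v))) (at x)"
      if "x \<in> S" for x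
      using Ck_on_SucD[OF Suc.prems(1) that] Ck_on_SucD[OF Suc.prems(2) that]
      by (rule has_derivative_Pair)
  qed (use Suc in auto)
qed

text \<open>The derivative of a composite, \<open>Dg (f x) (Df x v)\<close>, depends on \<open>x\<close> in two places. Expanding
  \<open>Df x v\<close> in a basis turns it into a sum of products of a scalar function and a partial derivative of
  \<open>g\<close> composed with \<open>f\<close>, to which the induction hypothesis applies.\<close>

lemma Ck_on_compose:
  fixes f :: "'a::real_normed_vector \<Rightarrow> 'b::real_normed_vector"
    and g :: "'b \<Rightarrow> 'c::real_normed_vector"
  assumes fd: "finite_dimensional TYPE('b)" and S: "open S"
    and "f ` S \<subseteq> T" "Ck_on k S f" "Ck_on k T g"
  shows "Ck_on k S (\<lambda>x. g (f x))"
  using assms(3-)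
proof (induction k arbitrary: g)
  case 0
  then show ?case using continuous_on_compose2[of T g S f] by auto
next
  case (Suc k)
  obtain B and c :: "'b \<Rightarrow> 'b \<Rightarrow> real"
    where B: "finite B" and c: "\<And>b. bounded_linear (c b)" and x: "\<And>x. x = (\<Sum>b\<in>B. c b x *\<^sub>R b)"
    using finite_dimensional_coordinates[OF fd] by blast
  let ?f = "\<lambda>x. frechet_derivative f (at x)" and ?g = "\<lambda>y. frechet_derivative g (at y)"
  show ?case
  proof (rule Ck_on_SucI[OF S])
    fix x assume xS: "x \<in> S"
    have f': "(f has_derivative ?f x) (at x)" using Ck_on_SucD[OF Suc.prems(2) xS] .
    have g': "(g has_derivative ?g (f x)) (at (f x))"
      using Ck_on_SucD[OF Suc.prems(3)] xS Suc.prems(1) by auto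
    have *: "?g (f x) w = (\<Sum>b\<in>B. c b w *\<^sub>R ?g (f x) b)" for w
    proof -
      interpret linear "?g (f x)" using g' by (rule has_derivative_linear)
      show ?thesis by (subst x[of w]) (simp add: sum scale)
    qed
    have "((\<lambda>x. g (f x)) has_derivative (\<lambda>v. ?g (f x) (?f x v))) (at x)"
      using has_derivative_compose[OF f' g'] by simp
    then show "((\<lambda>x. g (f x)) has_derivative (\<lambda>v. \<Sum>b\<in>B. c b (?f x v) *\<^sub>R ?g (f x) b)) (at x)"
      by (subst (asm) *)
  next
    fix v
    show "Ck_on k S (\<lambda>x. \<Sum>b\<in>B. c b (?f x v) *\<^sub>R ?g (f x) b)"
    proof (intro Ck_on_sum[OF S B] Ck_on_scaleR[OF S])
      fix b
      show "Ck_on k S (\<lambda>x. c b (?f x v))"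
        by (rule Ck_on_bounded_linear[OF c S]) (use Suc.prems in simp)
      show "Ck_on k S (\<lambda>x. ?g (f x) b)"
        by (rule Suc.IH[of "\<lambda>y. ?g y b"]) (use Suc.prems Ck_on_mono[OF Suc.prems(2)] in auto)
    qed
  qed
qed


section \<open>Tangent maps of maps between manifolds\<close>

text \<open>The part of a manifold structure on which derivatives depend, in two pieces because they are
  inherited differently: injectivity of the charts and the choice of a chart around every point
  (\<open>charted\<close>) pass to products and to arbitrary restrictions, openness of the chart images
  (\<open>open_charts\<close>) passes to products and to open submanifolds.\<close>

definition charted :: "('a, 'e) manifold \<Rightarrow> bool" where
  "charted M \<longleftrightarrow> (\<forall>c\<in>atlas M. inj_on (snd c) (fst c)) \<and>
     (\<forall>p\<in>mcarrier M. chart_at M p \<in> atlas M \<and> p \<in> fst (chart_at M p))"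

definition open_charts :: "('a, 'e::real_normed_vector) manifold \<Rightarrow> bool" where
  "open_charts M \<longleftrightarrow> (\<forall>c\<in>atlas M. open (snd c ` fst c))"

lemma smooth_manifold_charted:
  fixes M :: "('a, 'e::real_normed_vector) manifold"
  assumes "smooth_manifold M"
  shows "charted M" "open_charts M" "finite_dimensional TYPE('e)"
  using assms unfolding smooth_manifold_def charted_def open_charts_def by auto

lemma chart_at_prod [simp]:
  "chart_at (prod_manifold M N) (p, q) = prod_chart (chart_at M p) (chart_at N q)"
  by (simp add: prod_manifold_def)

lemma prod_chart_simps [simp]:
  "fst (prod_chart c d) = fst c \<times> fst d" "snd (prod_chart c d) (x, y) = (snd c x, snd d y)"
  by (simp_all add: prod_chart_def)

lemma atlas_prod: "atlas (prod_manifold M N) = (\<lambda>(c, d). prod_chart c d) ` (atlas M \<times> atlas N)"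
  by (auto simp: prod_manifold_def)

lemma mcarrier_prod [simp]: "mcarrier (prod_manifold M N) = mcarrier M \<times> mcarrier N"
  unfolding mcarrier_def atlas_prod by fastforce

lemma mcarrier_vec [simp]: "mcarrier vec_manifold = UNIV"
  by (simp add: mcarrier_def vec_manifold_def)

lemma chart_at_vec [simp]: "chart_at vec_manifold p = (UNIV, \<lambda>x. x)"
  by (simp add: vec_manifold_def)

lemma mcarrier_open_submanifold [simp]: "mcarrier (open_submanifold M W) = mcarrier M \<inter> W"
  by (auto simp: mcarrier_def open_submanifold_def split_beta)

lemma chart_at_open_submanifold [simp]:
  "chart_at (open_submanifold M W) p = (fst (chart_at M p) \<inter> W, snd (chart_at M p))"
  by (simp add: open_submanifold_def)

lemma inj_on_prod_chart:
  "inj_on (snd c) (fst c) \<Longrightarrow> inj_on (snd d) (fst d) \<Longrightarrow> inj_on (snd (prod_chart c d)) (fst (prod_chart c d))"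
  by (auto simp: inj_on_def)

lemma snd_prod_chart_image: "snd (prod_chart c d) ` (A \<times> C) = snd c ` A \<times> snd d ` C"
  by (force simp: image_iff)

lemma charted_prod: "charted M \<Longrightarrow> charted N \<Longrightarrow> charted (prod_manifold M N)"
  unfolding charted_def by (auto simp: atlas_prod intro!: inj_on_prod_chart[simplified])

lemma open_charts_prod: "open_charts M \<Longrightarrow> open_charts N \<Longrightarrow> open_charts (prod_manifold M N)"
  unfolding open_charts_def by (auto simp: atlas_prod snd_prod_chart_image intro!: open_Times)

lemma charted_vec: "charted vec_manifold" "open_charts vec_manifold"
  by (auto simp: charted_def open_charts_def vec_manifold_def)

lemma charted_open_submanifold: "charted M \<Longrightarrow> charted (open_submanifold M W)"
  unfolding charted_def
  by (auto simp: open_submanifold_def mcarrier_def split_beta image_iff intro: inj_on_subset)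

lemma open_charts_open_submanifold:
  assumes "smooth_manifold M" "openin (mtopology M) U"
  shows "open_charts (open_submanifold M U)"
  using assms openin_mtopology[OF assms(1), of U]
  by (auto simp: open_charts_def open_submanifold_def mopen_def Int_commute)

definition charted_at :: "('a, 'e) manifold \<Rightarrow> 'a \<Rightarrow> bool" where
  "charted_at M p \<longleftrightarrow>
     p \<in> fst (chart_at M p) \<and> inj_on (snd (chart_at M p)) (fst (chart_at M p))"

lemma charted_atI: "charted M \<Longrightarrow> p \<in> mcarrier M \<Longrightarrow> charted_at M p"
  by (force simp: charted_def charted_at_def)

lemma charted_at_vec [simp]: "charted_at vec_manifold p"
  by (simp add: charted_at_def)

text \<open>\<open>has_tangent M N F p D\<close> only looks at the germ of \<open>F\<close> at \<open>p\<close>. The third conjunct says that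
  the chart of \<open>M\<close> covers a neighbourhood of \<open>p\<close> which \<open>F\<close> maps into the chart of \<open>N\<close>, so that the
  coordinate representation, which is built from choice operators, has its intended meaning near \<open>p\<close>.\<close>

definition has_tangent ::
  "('a, 'e::real_normed_vector) manifold \<Rightarrow> ('b, 'f::real_normed_vector) manifold \<Rightarrow>
     ('a \<Rightarrow> 'b) \<Rightarrow> 'a \<Rightarrow> ('e \<Rightarrow> 'f) \<Rightarrow> bool" where
  "has_tangent M N F p D \<longleftrightarrow> charted_at M p \<and> charted_at N (F p) \<and>
     (\<forall>\<^sub>F y in nhds (snd (chart_at M p) p).
        y \<in> snd (chart_at M p) ` {x\<in>fst (chart_at M p). F x \<in> fst (chart_at N (F p))}) \<and>
     (snd (chart_at N (F p)) \<circ> F \<circ> inv_into (fst (chart_at M p)) (snd (chart_at M p))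
        has_derivative D) (at (snd (chart_at M p) p))"

lemma has_tangent_tangent_map: "has_tangent M N F p D \<Longrightarrow> tangent_map M N F p = D"
  unfolding has_tangent_def tangent_map_def using frechet_derivative_at by metis

lemma has_tangent_unique: "has_tangent M N F p D \<Longrightarrow> has_tangent M N F p E \<Longrightarrow> D = E"
  using has_tangent_tangent_map by metis

lemma has_tangent_unique_at: "has_tangent M N F p D \<Longrightarrow> has_tangent M N F p E \<Longrightarrow> D v = E v"
  using has_tangent_tangent_map by metis

lemma has_tangent_linear: "has_tangent M N F p D \<Longrightarrow> linear D"
  unfolding has_tangent_def using has_derivative_linear by blast

lemma smooth_map_has_tangent:
  assumes F: "smooth_map M N F" and M: "charted M" and N: "charted N" and p: "p \<in> mcarrier M"
  shows "has_tangent M N F p (tangent_map M N F p)"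
proof -
  let ?U = "fst (chart_at M p)" and ?\<phi> = "snd (chart_at M p)"
  let ?V = "fst (chart_at N (F p))" and ?\<psi> = "snd (chart_at N (F p))"
  let ?S = "?\<phi> ` {x\<in>?U. F x \<in> ?V}"
  have Fp: "F p \<in> mcarrier N" using F p by (auto simp: smooth_map_def)
  have c: "chart_at M p \<in> atlas M" "p \<in> ?U" "chart_at N (F p) \<in> atlas N" "F p \<in> ?V"
    using M N p Fp by (auto simp: charted_def)
  then have op: "open ?S" and sm: "smooth_on ?S (?\<psi> \<circ> F \<circ> inv_into ?U ?\<phi>)"
    using F unfolding smooth_map_def split_beta by auto
  have mem: "?\<phi> p \<in> ?S" using c by auto
  have "Ck_on (Suc 0) ?S (?\<psi> \<circ> F \<circ> inv_into ?U ?\<phi>)" using sm by (auto simp: smooth_on_def)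
  from Ck_on_SucD[OF this mem] show ?thesis
    unfolding has_tangent_def tangent_map_def
    using op mem charted_atI[OF M p] charted_atI[OF N Fp] eventually_nhds by blast
qed

text \<open>The coordinate representation of \<open>G \<circ> F\<close> is the composite of those of \<open>F\<close> and \<open>G\<close> only near the
  point, where \<open>F\<close> stays inside the chart of \<open>N\<close>; there the usual chain rule applies.\<close>

lemma has_tangent_compose:
  assumes F: "has_tangent M N F p D" and G: "has_tangent N P G (F p) E"
  shows "has_tangent M P (\<lambda>x. G (F x)) p (\<lambda>v. E (D v))"
proof -
  define U \<phi> V \<psi> W \<zeta> where c: "U = fst (chart_at M p)" "\<phi> = snd (chart_at M p)"
    "V = fst (chart_at N (F p))" "\<psi> = snd (chart_at N (F p))"
    "W = fst (chart_at P (G (F p)))" "\<zeta> = snd (chart_at P (G (F p)))"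
  let ?f = "\<psi> \<circ> F \<circ> inv_into U \<phi>" and ?g = "\<zeta> \<circ> G \<circ> inv_into V \<psi>"
  have inj: "inj_on \<phi> U" "inj_on \<psi> V" and p: "p \<in> U"
    using F G by (auto simp: has_tangent_def charted_at_def c)
  have f: "(?f has_derivative D) (at (\<phi> p))" and evf: "\<forall>\<^sub>F y in nhds (\<phi> p). y \<in> \<phi> ` {x\<in>U. F x \<in> V}"
    using F by (auto simp: has_tangent_def c)
  have g: "(?g has_derivative E) (at (\<psi> (F p)))"
    and evg: "\<forall>\<^sub>F z in nhds (\<psi> (F p)). z \<in> \<psi> ` {y\<in>V. G y \<in> W}"
    using G by (auto simp: has_tangent_def c)
  have fp: "?f (\<phi> p) = \<psi> (F p)" using inj p by simp
  have "isCont ?f (\<phi> p)" using f by (rule has_derivative_continuous)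
  then have "filterlim ?f (nhds (?f (\<phi> p))) (nhds (\<phi> p))"
    unfolding isCont_def tendsto_at_iff_tendsto_nhds .
  then have lim: "filterlim ?f (nhds (\<psi> (F p))) (nhds (\<phi> p))" by (simp only: fp)
  have ev: "\<forall>\<^sub>F y in nhds (\<phi> p). y \<in> \<phi> ` {x\<in>U. G (F x) \<in> W} \<and>
      ?g (?f y) = (\<zeta> \<circ> (\<lambda>x. G (F x)) \<circ> inv_into U \<phi>) y"
    using evf eventually_compose_filterlim[OF evg lim]
  proof eventually_elim
    case (elim y)
    then obtain x where x: "x \<in> U" "F x \<in> V" "y = \<phi> x" by auto
    have "\<psi> (F x) \<in> \<psi> ` {y\<in>V. G y \<in> W}" using elim(2) x inj by simp
    then have "G (F x) \<in> W" using x inj(2) by (auto dest: inj_onD)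
    then show ?case using x inj by auto
  qed
  have "((\<lambda>y. ?g (?f y)) has_derivative (\<lambda>v. E (D v))) (at (\<phi> p))"
    using has_derivative_compose[OF f, of ?g E] g fp by simp
  moreover have "\<forall>\<^sub>F y in at (\<phi> p). ?g (?f y) = (\<zeta> \<circ> (\<lambda>x. G (F x)) \<circ> inv_into U \<phi>) y"
    using ev by (auto simp: eventually_at_filter elim: eventually_mono)
  moreover have "?g (?f (\<phi> p)) = (\<zeta> \<circ> (\<lambda>x. G (F x)) \<circ> inv_into U \<phi>) (\<phi> p)"
    using eventually_nhds_x_imp_x[OF ev] by blast
  ultimately have "(\<zeta> \<circ> (\<lambda>x. G (F x)) \<circ> inv_into U \<phi> has_derivative (\<lambda>v. E (D v))) (at (\<phi> p))"
    using has_derivative_transform_eventually by blast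
  moreover have "\<forall>\<^sub>F y in nhds (\<phi> p). y \<in> \<phi> ` {x\<in>U. G (F x) \<in> W}"
    using ev by (rule eventually_mono) blast
  ultimately show ?thesis
    using F G by (simp add: has_tangent_def c)
qed

lemma charted_chart_subset: "charted M \<Longrightarrow> p \<in> mcarrier M \<Longrightarrow> fst (chart_at M p) \<subseteq> mcarrier M"
  by (auto simp: charted_def mcarrier_def)

lemma has_tangent_cong:
  assumes F: "has_tangent M N F p D" and M: "charted M" "p \<in> mcarrier M"
    and eq: "\<And>x. x \<in> mcarrier M \<Longrightarrow> F x = G x"
  shows "has_tangent M N G p D"
proof -
  let ?U = "fst (chart_at M p)" and ?\<phi> = "snd (chart_at M p)"
  have eqU: "F x = G x" if "x \<in> ?U" for x
    using eq charted_chart_subset[OF M] that by auto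
  have p: "p \<in> ?U" "inj_on ?\<phi> ?U" using F by (auto simp: has_tangent_def charted_at_def)
  have S: "{x\<in>?U. G x \<in> A} = {x\<in>?U. F x \<in> A}" for A using eqU by auto
  have Fp: "G p = F p" using eqU p by simp
  let ?r = "\<lambda>F. snd (chart_at N (F p)) \<circ> F \<circ> inv_into ?U ?\<phi>"
  have ev: "\<forall>\<^sub>F y in nhds (?\<phi> p). y \<in> ?\<phi> ` ?U"
    using F unfolding has_tangent_def by (auto elim: eventually_mono)
  then have "\<forall>\<^sub>F y in nhds (?\<phi> p). ?r F y = ?r G y"
    by (rule eventually_mono) (use p eqU Fp in auto)
  then have "\<forall>\<^sub>F y in at (?\<phi> p). ?r F y = ?r G y" by (auto simp: eventually_at_filter elim: eventually_mono)
  moreover have "?r F (?\<phi> p) = ?r G (?\<phi> p)" using p Fp by simp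
  moreover have "(?r F has_derivative D) (at (?\<phi> p))" using F by (simp add: has_tangent_def)
  ultimately have "(?r G has_derivative D) (at (?\<phi> p))"
    using has_derivative_transform_eventually by blast
  then show ?thesis using F unfolding has_tangent_def S Fp by simp
qed

lemma has_tangent_Pair:
  assumes F: "has_tangent M N F p D" and G: "has_tangent M P G p E"
  shows "has_tangent M (prod_manifold N P) (\<lambda>x. (F x, G x)) p (\<lambda>v. (D v, E v))"
proof -
  let ?U = "fst (chart_at M p)" and ?\<phi> = "snd (chart_at M p)"
  have inj: "inj_on ?\<phi> ?U" using F by (auto simp: has_tangent_def charted_at_def)
  have "\<forall>\<^sub>F y in nhds (?\<phi> p). y \<in> ?\<phi> ` {x\<in>?U. F x \<in> fst (chart_at N (F p))} \<and>
      y \<in> ?\<phi> ` {x\<in>?U. G x \<in> fst (chart_at P (G p))}"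
    using F G by (auto simp: has_tangent_def intro: eventually_conj)
  then have ev: "\<forall>\<^sub>F y in nhds (?\<phi> p). y \<in> ?\<phi> ` {x\<in>?U. (F x, G x) \<in>
      fst (chart_at (prod_manifold N P) (F p, G p))}"
    by (rule eventually_mono) (use inj in \<open>auto dest: inj_onD\<close>)
  define f g where "f = snd (chart_at N (F p)) \<circ> F \<circ> inv_into ?U ?\<phi>"
    and "g = snd (chart_at P (G p)) \<circ> G \<circ> inv_into ?U ?\<phi>"
  have "snd (prod_chart (chart_at N (F p)) (chart_at P (G p))) \<circ> (\<lambda>x. (F x, G x)) \<circ> inv_into ?U ?\<phi> =
      (\<lambda>y. (f y, g y))"
    by (auto simp: f_def g_def)
  moreover have "((\<lambda>y. (f y, g y)) has_derivative (\<lambda>v. (D v, E v))) (at (?\<phi> p))"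
    using F G unfolding has_tangent_def f_def g_def by (intro has_derivative_Pair) blast+
  ultimately have "(snd (prod_chart (chart_at N (F p)) (chart_at P (G p))) \<circ> (\<lambda>x. (F x, G x)) \<circ> inv_into ?U ?\<phi>
      has_derivative (\<lambda>v. (D v, E v))) (at (?\<phi> p))"
    by simp
  moreover have "charted_at (prod_manifold N P) (F p, G p)"
    using F G inj_on_prod_chart[of "chart_at N (F p)" "chart_at P (G p)"]
    by (simp add: has_tangent_def charted_at_def)
  ultimately show ?thesis using F ev by (simp add: has_tangent_def)
qed

lemma eventually_in_chart:
  assumes "charted M" "open_charts M" "p \<in> mcarrier M"
  shows "\<forall>\<^sub>F y in nhds (snd (chart_at M p) p). y \<in> snd (chart_at M p) ` fst (chart_at M p)"
proof -
  have "open (snd (chart_at M p) ` fst (chart_at M p))"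
    using assms unfolding charted_def open_charts_def split_beta by blast
  moreover have "p \<in> fst (chart_at M p)" using assms by (auto simp: charted_def)
  ultimately show ?thesis using eventually_nhds by blast
qed

lemma has_tangent_const:
  assumes "charted M" "open_charts M" "p \<in> mcarrier M" "charted N" "c \<in> mcarrier N"
  shows "has_tangent M N (\<lambda>x. c) p (\<lambda>v. 0)"
  using eventually_in_chart[OF assms(1-3)] charted_atI[OF assms(1,3)] charted_atI[OF assms(4,5)]
  by (simp add: has_tangent_def charted_at_def comp_def)

text \<open>A map that is linear in the preferred charts is, in these coordinates, its own tangent map. The
  identity and the projections of a product are of this kind.\<close>

lemma has_tangent_via_coordinates:
  assumes M: "charted_at M p" and N: "charted_at N (F p)"
    and ev: "\<forall>\<^sub>F y in nhds (snd (chart_at M p) p). y \<in> snd (chart_at M p) ` fst (chart_at M p)"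
    and F: "\<And>x. x \<in> fst (chart_at M p) \<Longrightarrow>
      F x \<in> fst (chart_at N (F p)) \<and> snd (chart_at N (F p)) (F x) = D (snd (chart_at M p) x)"
    and D: "bounded_linear D"
  shows "has_tangent M N F p D"
proof -
  let ?U = "fst (chart_at M p)" and ?\<phi> = "snd (chart_at M p)" and ?\<psi> = "snd (chart_at N (F p))"
  have p: "p \<in> ?U" "inj_on ?\<phi> ?U" using M by (auto simp: charted_at_def)
  have S: "{x\<in>?U. F x \<in> fst (chart_at N (F p))} = ?U" using F by auto
  have "\<forall>\<^sub>F y in nhds (?\<phi> p). D y = (?\<psi> \<circ> F \<circ> inv_into ?U ?\<phi>) y"
    using ev by (rule eventually_mono) (use F p in auto)
  then have "\<forall>\<^sub>F y in at (?\<phi> p). D y = (?\<psi> \<circ> F \<circ> inv_into ?U ?\<phi>) y"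
    by (auto simp: eventually_at_filter elim: eventually_mono)
  moreover have "D (?\<phi> p) = (?\<psi> \<circ> F \<circ> inv_into ?U ?\<phi>) (?\<phi> p)" using F p by auto
  moreover have "(D has_derivative D) (at (?\<phi> p))" using D by (rule bounded_linear_imp_has_derivative)
  ultimately have "(?\<psi> \<circ> F \<circ> inv_into ?U ?\<phi> has_derivative D) (at (?\<phi> p))"
    using has_derivative_transform_eventually by blast
  then show ?thesis using M N ev S by (simp add: has_tangent_def)
qed

lemma has_tangent_id:
  assumes "charted M" "open_charts M" "p \<in> mcarrier M"
  shows "has_tangent M M (\<lambda>x. x) p (\<lambda>v. v)"
  by (rule has_tangent_via_coordinates)
    (use eventually_in_chart[OF assms] charted_atI[OF assms(1,3)] in auto)

lemma has_tangent_fst: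
  assumes "charted M" "open_charts M" "p \<in> mcarrier M" "charted N" "open_charts N" "q \<in> mcarrier N"
  shows "has_tangent (prod_manifold M N) M fst (p, q) fst"
  by (rule has_tangent_via_coordinates)
    (use eventually_in_chart[OF charted_prod[OF assms(1,4)] open_charts_prod[OF assms(2,5)], of "(p, q)"]
      charted_atI[OF charted_prod[OF assms(1,4)], of "(p, q)"] charted_atI[OF assms(1,3)] assms
      in \<open>auto simp: bounded_linear_fst\<close>)

lemma has_tangent_snd:
  assumes "charted M" "open_charts M" "p \<in> mcarrier M" "charted N" "open_charts N" "q \<in> mcarrier N"
  shows "has_tangent (prod_manifold M N) N snd (p, q) snd"
  by (rule has_tangent_via_coordinates)
    (use eventually_in_chart[OF charted_prod[OF assms(1,4)] open_charts_prod[OF assms(2,5)], of "(p, q)"]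
      charted_atI[OF charted_prod[OF assms(1,4)], of "(p, q)"] charted_atI[OF assms(4,6)] assms
      in \<open>auto simp: bounded_linear_snd\<close>)

text \<open>Tangent vectors of an open submanifold are represented in the coordinates of the ambient
  manifold, so tangent maps do not notice the restriction of source or target.\<close>

lemma has_tangent_to_open_superset:
  assumes F: "has_tangent M (open_submanifold N W) F p D" and N: "charted_at N (F p)"
  shows "has_tangent M N F p D"
  using F N unfolding has_tangent_def by (auto elim!: eventually_mono)

lemma has_tangent_from_open_superset:
  assumes F: "has_tangent (open_submanifold M W) N F p D" and M: "charted_at M p"
  shows "has_tangent M N F p D"
proof -
  let ?U = "fst (chart_at M p)" and ?\<phi> = "snd (chart_at M p)" and ?\<psi> = "snd (chart_at N (F p))"
  have p: "p \<in> ?U" "p \<in> W" "inj_on ?\<phi> ?U" and inj: "inj_on ?\<phi> (?U \<inter> W)"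
    using F M by (auto simp: has_tangent_def charted_at_def)
  have ev: "\<forall>\<^sub>F y in nhds (?\<phi> p). y \<in> ?\<phi> ` {x\<in>?U \<inter> W. F x \<in> fst (chart_at N (F p))}"
    using F by (simp add: has_tangent_def)
  have eq: "(?\<psi> \<circ> F \<circ> inv_into (?U \<inter> W) ?\<phi>) y = (?\<psi> \<circ> F \<circ> inv_into ?U ?\<phi>) y" if "y \<in> ?\<phi> ` (?U \<inter> W)" for y
    using that p inj by auto
  have "\<forall>\<^sub>F y in nhds (?\<phi> p). (?\<psi> \<circ> F \<circ> inv_into (?U \<inter> W) ?\<phi>) y = (?\<psi> \<circ> F \<circ> inv_into ?U ?\<phi>) y"
    using ev by (rule eventually_mono) (rule eq, auto)
  then have "\<forall>\<^sub>F y in at (?\<phi> p). (?\<psi> \<circ> F \<circ> inv_into (?U \<inter> W) ?\<phi>) y = (?\<psi> \<circ> F \<circ> inv_into ?U ?\<phi>) y"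
    by (auto simp: eventually_at_filter elim: eventually_mono)
  moreover have "(?\<psi> \<circ> F \<circ> inv_into (?U \<inter> W) ?\<phi>) (?\<phi> p) = (?\<psi> \<circ> F \<circ> inv_into ?U ?\<phi>) (?\<phi> p)"
    by (rule eq) (use p in auto)
  moreover have "(?\<psi> \<circ> F \<circ> inv_into (?U \<inter> W) ?\<phi> has_derivative D) (at (?\<phi> p))"
    using F by (simp add: has_tangent_def)
  ultimately have "(?\<psi> \<circ> F \<circ> inv_into ?U ?\<phi> has_derivative D) (at (?\<phi> p))"
    using has_derivative_transform_eventually by blast
  moreover have "\<forall>\<^sub>F y in nhds (?\<phi> p). y \<in> ?\<phi> ` {x\<in>?U. F x \<in> fst (chart_at N (F p))}"
    using ev by (rule eventually_mono) auto
  ultimately show ?thesis using F M by (simp add: has_tangent_def)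
qed


lemma has_tangent_open_submanifold:
  assumes "has_tangent (open_submanifold M W) N F p D" "charted_at M p"
  shows "has_tangent (open_submanifold M W) N F p (tangent_map M N F p)"
  using has_tangent_tangent_map[OF has_tangent_from_open_superset[OF assms]] assms(1) by simp


section \<open>Smooth maps and smooth curves\<close>

text \<open>Smoothness is local, so around each point a chart of the middle manifold can be inserted; finite
  dimension of its model space is what the chain rule for \<open>Ck_on\<close> asks for.\<close>

lemma smooth_map_compose:
  fixes N :: "('b, 'f::real_normed_vector) manifold"
  assumes F: "smooth_map M N F" and G: "smooth_map N P G"
    and M: "charted M" and N: "charted N" and fd: "finite_dimensional TYPE('f)"
  shows "smooth_map M P (\<lambda>x. G (F x))"
proof -
  have "open (\<phi> ` {x\<in>U. G (F x) \<in> W}) \<and>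
      smooth_on (\<phi> ` {x\<in>U. G (F x) \<in> W}) (\<zeta> \<circ> (\<lambda>x. G (F x)) \<circ> inv_into U \<phi>)"
    if U: "(U, \<phi>) \<in> atlas M" and W: "(W, \<zeta>) \<in> atlas P" for U \<phi> W \<zeta>
  proof -
    let ?S = "\<phi> ` {x\<in>U. G (F x) \<in> W}" and ?h = "\<zeta> \<circ> (\<lambda>x. G (F x)) \<circ> inv_into U \<phi>"
    have inj: "inj_on \<phi> U" using M U by (auto simp: charted_def)
    have loc: "\<exists>T. open T \<and> y \<in> T \<and> T \<subseteq> ?S \<and> (\<forall>k. Ck_on k T ?h)" if "y \<in> ?S" for y
    proof -
      obtain x where x: "x \<in> U" "G (F x) \<in> W" "y = \<phi> x" using \<open>y \<in> ?S\<close> by auto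
      have "x \<in> mcarrier M" using U x by (auto simp: mcarrier_def intro!: bexI[of _ "(U, \<phi>)"])
      then have "F x \<in> mcarrier N" using F by (auto simp: smooth_map_def)
      then obtain V \<psi> where V: "(V, \<psi>) \<in> atlas N" "F x \<in> V"
        using N by (cases "chart_at N (F x)") (auto simp: charted_def)
      have injV: "inj_on \<psi> V" using N V by (auto simp: charted_def)
      let ?A = "\<phi> ` {x\<in>U. F x \<in> V}" and ?B = "\<psi> ` {y\<in>V. G y \<in> W}"
      let ?f = "\<psi> \<circ> F \<circ> inv_into U \<phi>" and ?g = "\<zeta> \<circ> G \<circ> inv_into V \<psi>"
      have A: "open ?A" "smooth_on ?A ?f"
        using F U V(1) unfolding smooth_map_def by blast+
      have B: "open ?B" "smooth_on ?B ?g"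
        using G W V(1) unfolding smooth_map_def by blast+
      define T where "T = ?A \<inter> ?f -` ?B"
      have "Ck_on 0 ?A ?f" using A(2) unfolding smooth_on_def by blast
      then have oT: "open T" unfolding T_def
        using continuous_open_preimage[OF _ A(1) B(1), of ?f] by simp
      have eT: "\<exists>x\<in>U. F x \<in> V \<and> G (F x) \<in> W \<and> z = \<phi> x" if z: "z \<in> T" for z
      proof -
        obtain x where x: "x \<in> U" "F x \<in> V" "z = \<phi> x" using z by (auto simp: T_def)
        have "\<psi> (F x) \<in> ?B" using z x inj by (simp add: T_def)
        then have "G (F x) \<in> W" using x injV by (auto dest: inj_onD)
        then show ?thesis using x by blast
      qed
      have "Ck_on k T ?h" for k
      proof (rule Ck_on_cong[OF oT, of "\<lambda>y. ?g (?f y)"])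
        show "Ck_on k T (\<lambda>y. ?g (?f y))"
        proof (rule Ck_on_compose[OF fd oT])
          show "?f ` T \<subseteq> ?B" by (auto simp: T_def)
          show "Ck_on k T ?f"
            by (rule Ck_on_subset[of _ ?A]) (use A(2) in \<open>auto simp: smooth_on_def T_def\<close>)
          show "Ck_on k ?B ?g" using B(2) by (auto simp: smooth_on_def)
        qed
        show "?g (?f z) = ?h z" if "z \<in> T" for z
          using eT[OF that] inj injV by auto
      qed
      moreover have "y \<in> T" using x V inj unfolding T_def by auto
      moreover have "T \<subseteq> ?S" using eT by blast
      ultimately show ?thesis using oT by blast
    qed
    have "open ?S" using loc by (subst open_subopen) blast
    moreover have "Ck_on k ?S ?h" for k by (rule Ck_on_local) (use loc in blast)
    ultimately show ?thesis unfolding smooth_on_def by blast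
  qed
  moreover have "(\<lambda>x. G (F x)) ` mcarrier M \<subseteq> mcarrier P"
    using F G unfolding smooth_map_def by blast
  ultimately show ?thesis unfolding smooth_map_def by blast
qed

lemma smooth_map_Pair:
  assumes F: "smooth_map M N F" and G: "smooth_map M P G" and M: "charted M"
  shows "smooth_map M (prod_manifold N P) (\<lambda>x. (F x, G x))"
  unfolding smooth_map_def
proof (intro conjI)
  show "(\<lambda>x. (F x, G x)) ` mcarrier M \<subseteq> mcarrier (prod_manifold N P)"
    using F G by (auto simp: smooth_map_def)
  show "\<forall>(U, \<phi>)\<in>atlas M. \<forall>(V, \<psi>)\<in>atlas (prod_manifold N P).
      open (\<phi> ` {p \<in> U. (F p, G p) \<in> V}) \<and>
      smooth_on (\<phi> ` {p \<in> U. (F p, G p) \<in> V}) (\<psi> \<circ> (\<lambda>x. (F x, G x)) \<circ> inv_into U \<phi>)"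
  proof (clarify)
    fix U \<phi> V \<psi> assume U: "(U, \<phi>) \<in> atlas M" and "(V, \<psi>) \<in> atlas (prod_manifold N P)"
    then obtain V1 \<psi>1 V2 \<psi>2 where V: "(V1, \<psi>1) \<in> atlas N" "(V2, \<psi>2) \<in> atlas P"
        "V = V1 \<times> V2" "\<psi> = (\<lambda>(x, y). (\<psi>1 x, \<psi>2 y))"
      by (force simp: prod_manifold_def prod_chart_def)
    have inj: "inj_on \<phi> U" using M U by (auto simp: charted_def)
    let ?A = "\<phi> ` {x\<in>U. F x \<in> V1}" and ?B = "\<phi> ` {x\<in>U. G x \<in> V2}"
    have A: "open ?A" "smooth_on ?A (\<psi>1 \<circ> F \<circ> inv_into U \<phi>)"
      using F U V unfolding smooth_map_def by blast+
    have B: "open ?B" "smooth_on ?B (\<psi>2 \<circ> G \<circ> inv_into U \<phi>)"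
      using G U V unfolding smooth_map_def by blast+
    have S: "\<phi> ` {p \<in> U. (F p, G p) \<in> V} = ?A \<inter> ?B"
      using inj V(3) by (auto dest: inj_onD)
    have "open (?A \<inter> ?B)" using A B by blast
    moreover have "\<psi> \<circ> (\<lambda>x. (F x, G x)) \<circ> inv_into U \<phi> =
        (\<lambda>y. ((\<psi>1 \<circ> F \<circ> inv_into U \<phi>) y, (\<psi>2 \<circ> G \<circ> inv_into U \<phi>) y))"
      using V(4) by auto
    moreover have "Ck_on k (?A \<inter> ?B) (\<psi>1 \<circ> F \<circ> inv_into U \<phi>)" for k
      using A(2) Ck_on_subset unfolding smooth_on_def by blast
    moreover have "Ck_on k (?A \<inter> ?B) (\<psi>2 \<circ> G \<circ> inv_into U \<phi>)" for k
      using B(2) Ck_on_subset unfolding smooth_on_def by blast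
    ultimately show "open (\<phi> ` {p \<in> U. (F p, G p) \<in> V}) \<and>
        smooth_on (\<phi> ` {p \<in> U. (F p, G p) \<in> V}) (\<psi> \<circ> (\<lambda>x. (F x, G x)) \<circ> inv_into U \<phi>)"
      unfolding S smooth_on_def by (simp only: Ck_on_Pair simp_thms)
  qed
qed

lemma smooth_map_id: "smooth_manifold M \<Longrightarrow> smooth_map M M (\<lambda>x. x)"
  unfolding smooth_map_def smooth_manifold_def by (auto simp: Int_def comp_def)

lemma smooth_map_prod_map:
  fixes M :: "('a, 'e::real_normed_vector) manifold" and N :: "('b, 'f::real_normed_vector) manifold"
  assumes F: "smooth_map M M' F" and G: "smooth_map N N' G"
    and ch: "charted M" "charted N"
    and fd: "finite_dimensional TYPE('e)" "finite_dimensional TYPE('f)"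
  shows "smooth_map (prod_manifold M N) (prod_manifold M' N') (\<lambda>(x, y). (F x, G y))"
proof -
  have "open (snd c ` {p\<in>fst c. (case p of (x, y) \<Rightarrow> (F x, G y)) \<in> fst d}) \<and>
      smooth_on (snd c ` {p\<in>fst c. (case p of (x, y) \<Rightarrow> (F x, G y)) \<in> fst d})
        (snd d \<circ> (\<lambda>(x, y). (F x, G y)) \<circ> inv_into (fst c) (snd c))"
    if cd: "c \<in> atlas (prod_manifold M N)" "d \<in> atlas (prod_manifold M' N')" for c d
  proof -
    obtain c1 c2 d1 d2 where c: "c = prod_chart c1 c2" "c1 \<in> atlas M" "c2 \<in> atlas N"
      and d: "d = prod_chart d1 d2" "d1 \<in> atlas M'" "d2 \<in> atlas N'"
      using cd by (auto simp: atlas_prod)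
    have inj: "inj_on (snd c1) (fst c1)" "inj_on (snd c2) (fst c2)"
      using ch c by (auto simp: charted_def)
    let ?A = "snd c1 ` {x\<in>fst c1. F x \<in> fst d1}" and ?B = "snd c2 ` {x\<in>fst c2. G x \<in> fst d2}"
    let ?f = "snd d1 \<circ> F \<circ> inv_into (fst c1) (snd c1)"
    let ?g = "snd d2 \<circ> G \<circ> inv_into (fst c2) (snd c2)"
    have A: "open ?A" "smooth_on ?A ?f" and B: "open ?B" "smooth_on ?B ?g"
      using F G c d unfolding smooth_map_def split_beta by blast+
    have S: "snd c ` {p\<in>fst c. (case p of (x, y) \<Rightarrow> (F x, G y)) \<in> fst d} = ?A \<times> ?B"
      using snd_prod_chart_image[of c1 c2 "{x\<in>fst c1. F x \<in> fst d1}" "{x\<in>fst c2. G x \<in> fst d2}"]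
      unfolding c(1) d(1) by (auto intro!: arg_cong[where f = "image _"])
    have op: "open (?A \<times> ?B)" using A B by (intro open_Times)
    have "Ck_on k (?A \<times> ?B) (snd d \<circ> (\<lambda>(x, y). (F x, G y)) \<circ> inv_into (fst c) (snd c))" for k
    proof (rule Ck_on_cong[OF op, of "\<lambda>z. (?f (fst z), ?g (snd z))"])
      have 1: "Ck_on k (?A \<times> ?B) fst" "Ck_on k (?A \<times> ?B) snd"
        using op by (auto intro!: Ck_on_bounded_linear[where f = "\<lambda>x. x"] Ck_on_id
            bounded_linear_fst bounded_linear_snd)
      have 2: "Ck_on k (?A \<times> ?B) (\<lambda>z. ?f (fst z))"
        by (rule Ck_on_compose[OF fd(1) op _ 1(1), of ?A ?f]) (use A in \<open>auto simp: smooth_on_def\<close>)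
      have 3: "Ck_on k (?A \<times> ?B) (\<lambda>z. ?g (snd z))"
        by (rule Ck_on_compose[OF fd(2) op _ 1(2), of ?B ?g]) (use B in \<open>auto simp: smooth_on_def\<close>)
      show "Ck_on k (?A \<times> ?B) (\<lambda>z. (?f (fst z), ?g (snd z)))"
        by (rule Ck_on_Pair[OF op 2 3])
      fix z assume "z \<in> ?A \<times> ?B"
      then obtain x y where z: "z = (snd c1 x, snd c2 y)" "x \<in> fst c1" "y \<in> fst c2" by auto
      have "inv_into (fst c) (snd c) (snd c (x, y)) = (x, y)"
        by (rule inv_into_f_f) (use inj_on_prod_chart[OF inj] z c(1) in auto)
      then show "(?f (fst z), ?g (snd z)) = (snd d \<circ> (\<lambda>(x, y). (F x, G y)) \<circ> inv_into (fst c) (snd c)) z"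
        using z inj c(1) d(1) by simp
    qed
    then show ?thesis unfolding S smooth_on_def using op by simp
  qed
  moreover have "(\<lambda>(x, y). (F x, G y)) ` mcarrier (prod_manifold M N) \<subseteq> mcarrier (prod_manifold M' N')"
    using F G by (auto simp: smooth_map_def)
  ultimately show ?thesis unfolding smooth_map_def split_beta by simp
qed

text \<open>Every tangent vector is the velocity of a smooth curve: a straight segment in the preferred
  chart. Smoothness in the other charts is that of the transition maps.\<close>

lemma straight_curve:
  fixes Q :: "('q, 'e::real_normed_vector) manifold"
  assumes Q: "smooth_manifold Q" and q: "q \<in> mcarrier Q"
  obtains \<gamma> \<epsilon> where "\<epsilon> > 0" "\<gamma> 0 = q"
    "smooth_map (open_submanifold vec_manifold {-\<epsilon><..<\<epsilon>::real}) Q \<gamma>"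
    "has_tangent vec_manifold Q \<gamma> 0 (\<lambda>t. t *\<^sub>R u)"
proof -
  note ch = smooth_manifold_charted[OF Q]
  obtain U \<phi> where c: "chart_at Q q = (U, \<phi>)" by fastforce
  have U: "(U, \<phi>) \<in> atlas Q" "q \<in> U" "inj_on \<phi> U" "open (\<phi> ` U)"
    using ch q c unfolding charted_def open_charts_def by force+
  define a where "a t = \<phi> q + t *\<^sub>R u" for t :: real
  define \<gamma> where "\<gamma> t = inv_into U \<phi> (a t)" for t
  have a: "Ck_on k S a" if "open S" for k S
    unfolding a_def using that
    by (intro Ck_on_add Ck_on_const Ck_on_bounded_linear[OF bounded_linear_scaleR_left] Ck_on_id)
  have conta: "continuous_on UNIV a" using a[of UNIV 0] by simp
  have "open (a -` (\<phi> ` U))" using conta U(4) by (simp add: open_vimage)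
  moreover have "0 \<in> a -` (\<phi> ` U)" using U by (simp add: a_def)
  ultimately obtain \<epsilon> where \<epsilon>: "\<epsilon> > 0" "ball 0 \<epsilon> \<subseteq> a -` (\<phi> ` U)"
    using openE by blast
  define I where "I = {-\<epsilon><..<\<epsilon>}"
  have I: "a t \<in> \<phi> ` U" if "t \<in> I" for t
    using \<epsilon>(2) that by (auto simp: I_def subset_iff)
  have \<gamma>U: "\<gamma> t \<in> U" "\<phi> (\<gamma> t) = a t" if "t \<in> I" for t
    unfolding \<gamma>_def using I[OF that] by (auto intro: inv_into_into f_inv_into_f)
  have smooth: "open {t\<in>I. \<gamma> t \<in> V} \<and> smooth_on {t\<in>I. \<gamma> t \<in> V} (\<psi> \<circ> \<gamma> \<circ> inv_into I (\<lambda>x. x))"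
    if V: "(V, \<psi>) \<in> atlas Q" for V \<psi>
  proof -
    have tr: "open (\<phi> ` (U \<inter> V))" "smooth_on (\<phi> ` (U \<inter> V)) (\<psi> \<circ> inv_into U \<phi>)"
      using Q U(1) V unfolding smooth_manifold_def by blast+
    have S: "{t\<in>I. \<gamma> t \<in> V} = I \<inter> a -` (\<phi> ` (U \<inter> V))"
    proof (intro Set.set_eqI iffI)
      fix t assume "t \<in> I \<inter> a -` (\<phi> ` (U \<inter> V))"
      then show "t \<in> {t\<in>I. \<gamma> t \<in> V}" using U(3) by (auto simp: \<gamma>_def)
    next
      fix t assume t: "t \<in> {t\<in>I. \<gamma> t \<in> V}"
      then have "a t = \<phi> (\<gamma> t)" "\<gamma> t \<in> U \<inter> V" using \<gamma>U by auto
      then show "t \<in> I \<inter> a -` (\<phi> ` (U \<inter> V))" using t by auto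
    qed
    have op: "open {t\<in>I. \<gamma> t \<in> V}"
      unfolding S unfolding I_def using conta tr(1) by (intro open_Int open_vimage) auto
    have "Ck_on k {t\<in>I. \<gamma> t \<in> V} (\<psi> \<circ> \<gamma> \<circ> inv_into I (\<lambda>x. x))" for k
    proof (rule Ck_on_cong[OF op, of "\<lambda>t. (\<psi> \<circ> inv_into U \<phi>) (a t)"])
      show "Ck_on k {t\<in>I. \<gamma> t \<in> V} (\<lambda>t. (\<psi> \<circ> inv_into U \<phi>) (a t))"
      proof (rule Ck_on_compose[OF ch(3) op, where f = a and g = "\<psi> \<circ> inv_into U \<phi>"])
        show "a ` {t\<in>I. \<gamma> t \<in> V} \<subseteq> \<phi> ` (U \<inter> V)" unfolding S by auto
        show "Ck_on k (\<phi> ` (U \<inter> V)) (\<psi> \<circ> inv_into U \<phi>)" using tr(2) by (simp add: smooth_on_def)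
      qed (rule a[OF op])
      show "(\<psi> \<circ> inv_into U \<phi>) (a t) = (\<psi> \<circ> \<gamma> \<circ> inv_into I (\<lambda>x. x)) t" if "t \<in> {t\<in>I. \<gamma> t \<in> V}" for t
        using that inv_into_f_f[of "\<lambda>x. x" I t] by (simp add: \<gamma>_def)
    qed
    then show ?thesis using op by (simp add: smooth_on_def)
  qed
  have "\<gamma> ` I \<subseteq> mcarrier Q" using \<gamma>U U(1) by (auto simp: mcarrier_def)
  then have sm: "smooth_map (open_submanifold vec_manifold I) Q \<gamma>"
    using smooth unfolding smooth_map_def by (auto simp: open_submanifold_def vec_manifold_def mcarrier_def)
  have \<gamma>0: "\<gamma> 0 = q" using U by (simp add: \<gamma>_def a_def)
  have I0: "0 \<in> I" using \<epsilon>(1) by (simp add: I_def)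
  have ht: "has_tangent vec_manifold Q \<gamma> 0 (tangent_map (open_submanifold vec_manifold I) Q \<gamma> 0)"
    by (rule has_tangent_from_open_superset[OF smooth_map_has_tangent[OF sm]])
      (use I0 in \<open>auto intro: charted_open_submanifold charted_vec ch\<close>)
  then have "(\<phi> \<circ> \<gamma> \<circ> inv_into UNIV (\<lambda>x. x) has_derivative tangent_map (open_submanifold vec_manifold I) Q \<gamma> 0) (at 0)"
    by (simp add: has_tangent_def \<gamma>0 c)
  moreover have "(\<phi> \<circ> \<gamma> \<circ> inv_into UNIV (\<lambda>x. x) has_derivative (\<lambda>t. t *\<^sub>R u)) (at 0)"
  proof (rule has_derivative_transform_within_open[of a _ _ _ I])
    show "(a has_derivative (\<lambda>t. t *\<^sub>R u)) (at 0)"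
      unfolding a_def by (auto intro!: derivative_eq_intros)
    show "a t = (\<phi> \<circ> \<gamma> \<circ> inv_into UNIV (\<lambda>x. x)) t" if "t \<in> I" for t
      using \<gamma>U[OF that] inv_into_f_f[of "\<lambda>x. x" UNIV t] by simp
  qed (use I0 in \<open>auto simp: I_def\<close>)
  ultimately have "tangent_map (open_submanifold vec_manifold I) Q \<gamma> 0 = (\<lambda>t. t *\<^sub>R u)"
    by (rule has_derivative_unique)
  then show thesis using that[of \<epsilon> \<gamma>] \<epsilon>(1) \<gamma>0 sm ht by (simp add: I_def)
qed

lemma smooth_curve_restrict:
  fixes \<gamma> :: "real \<Rightarrow> 'a" and M :: "('a, 'e::real_normed_vector) manifold"
  assumes \<gamma>: "smooth_map (open_submanifold vec_manifold I) M \<gamma>" and J: "open J" "J \<subseteq> I"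
  shows "smooth_map (open_submanifold vec_manifold J) M \<gamma>"
proof -
  have "open {t\<in>J. \<gamma> t \<in> V} \<and> smooth_on {t\<in>J. \<gamma> t \<in> V} (\<psi> \<circ> \<gamma> \<circ> inv_into J (\<lambda>x. x))"
    if V: "(V, \<psi>) \<in> atlas M" for V \<psi>
  proof -
    have I: "open {t\<in>I. \<gamma> t \<in> V}" "smooth_on {t\<in>I. \<gamma> t \<in> V} (\<psi> \<circ> \<gamma> \<circ> inv_into I (\<lambda>x. x))"
      using \<gamma> V unfolding smooth_map_def by (auto simp: open_submanifold_def vec_manifold_def)
    have "{t\<in>J. \<gamma> t \<in> V} = J \<inter> {t\<in>I. \<gamma> t \<in> V}" using J by auto
    then have op: "open {t\<in>J. \<gamma> t \<in> V}" using I J by auto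
    have "Ck_on k {t\<in>J. \<gamma> t \<in> V} (\<psi> \<circ> \<gamma> \<circ> inv_into J (\<lambda>x. x))" for k
    proof (rule Ck_on_cong[OF op])
      have "Ck_on k {t\<in>I. \<gamma> t \<in> V} (\<psi> \<circ> \<gamma> \<circ> inv_into I (\<lambda>x. x))"
        using I(2) by (simp add: smooth_on_def)
      then show "Ck_on k {t\<in>J. \<gamma> t \<in> V} (\<psi> \<circ> \<gamma> \<circ> inv_into I (\<lambda>x. x))"
        by (rule Ck_on_subset) (use J in auto)
      show "(\<psi> \<circ> \<gamma> \<circ> inv_into I (\<lambda>x. x)) t = (\<psi> \<circ> \<gamma> \<circ> inv_into J (\<lambda>x. x)) t"
        if "t \<in> {t\<in>J. \<gamma> t \<in> V}" for t
        using that J inv_into_f_f[of "\<lambda>x. x" I t] inv_into_f_f[of "\<lambda>x. x" J t] by auto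
    qed
    then show ?thesis using op by (simp add: smooth_on_def)
  qed
  moreover have "\<gamma> ` J \<subseteq> mcarrier M" using \<gamma> J(2) by (auto simp: smooth_map_def)
  ultimately show ?thesis
    unfolding smooth_map_def by (auto simp: open_submanifold_def vec_manifold_def mcarrier_def)
qed



section \<open>Lie groups\<close>

lemma lie_group_manifold:
  assumes "lie_group G GM"
  shows "charted GM" "open_charts GM" "mcarrier GM = carrier G" "group G"
  using assms smooth_manifold_charted by (auto simp: lie_group_def)

lemma lie_group_mult_tangent:
  fixes G (structure)
  assumes G: "lie_group G GM" and "k \<in> carrier G" "h \<in> carrier G"
  shows "has_tangent (prod_manifold GM GM) GM (\<lambda>(g, h). g \<otimes> h) (k, h)
    (tangent_map (prod_manifold GM GM) GM (\<lambda>(g, h). g \<otimes> h) (k, h))"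
  by (rule smooth_map_has_tangent)
    (use assms lie_group_manifold[OF G] in \<open>auto simp: lie_group_def intro: charted_prod\<close>)

lemma lie_group_right_mult_tangent:
  fixes G (structure)
  assumes G: "lie_group G GM" and kh: "k \<in> carrier G" "h \<in> carrier G"
  shows "has_tangent GM GM (\<lambda>g. g \<otimes> h) k (tangent_map GM GM (\<lambda>g. g \<otimes> h) k)"
proof -
  have "has_tangent GM (prod_manifold GM GM) (\<lambda>g. (g, h)) k (\<lambda>v. (v, 0))"
    using kh lie_group_manifold[OF G]
    by (intro has_tangent_Pair has_tangent_const has_tangent_id) auto
  from has_tangent_compose[OF this lie_group_mult_tangent[OF G kh]]
  have "has_tangent GM GM (\<lambda>g. g \<otimes> h) k
      (\<lambda>v. tangent_map (prod_manifold GM GM) GM (\<lambda>(g, h). g \<otimes> h) (k, h) (v, 0))" by simp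
  then show ?thesis using has_tangent_tangent_map by metis
qed

lemma lie_group_left_mult_tangent:
  fixes G (structure)
  assumes G: "lie_group G GM" and kh: "k \<in> carrier G" "h \<in> carrier G"
  shows "has_tangent GM GM (\<lambda>g. k \<otimes> g) h (tangent_map GM GM (\<lambda>g. k \<otimes> g) h)"
proof -
  have "has_tangent GM (prod_manifold GM GM) (\<lambda>g. (k, g)) h (\<lambda>v. (0, v))"
    using kh lie_group_manifold[OF G]
    by (intro has_tangent_Pair has_tangent_const has_tangent_id) auto
  from has_tangent_compose[OF this lie_group_mult_tangent[OF G kh]]
  have "has_tangent GM GM (\<lambda>g. k \<otimes> g) h
      (\<lambda>v. tangent_map (prod_manifold GM GM) GM (\<lambda>(g, h). g \<otimes> h) (k, h) (0, v))" by simp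
  then show ?thesis using has_tangent_tangent_map by metis
qed

lemma Ad_tangent:
  fixes G (structure)
  assumes G: "lie_group G GM" and k: "k \<in> carrier G"
  shows "has_tangent GM GM (\<lambda>h. k \<otimes> h \<otimes> inv k) \<one> (Ad G GM k)"
proof -
  interpret group G using lie_group_manifold[OF G] by simp
  have "has_tangent GM GM (\<lambda>g. k \<otimes> g) \<one> (tangent_map GM GM (\<lambda>g. k \<otimes> g) \<one>)"
    using lie_group_left_mult_tangent[OF G] k by simp
  from has_tangent_compose[OF this lie_group_right_mult_tangent[OF G, of _ "inv k"]] k
  have "has_tangent GM GM (\<lambda>h. k \<otimes> h \<otimes> inv k) \<one>
      (\<lambda>v. tangent_map GM GM (\<lambda>g. g \<otimes> inv k) (k \<otimes> \<one>) (tangent_map GM GM (\<lambda>g. k \<otimes> g) \<one> v))" by simp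
  then show ?thesis unfolding Ad_def using has_tangent_tangent_map by metis
qed


section \<open>Discrete mechanical systems with symmetry\<close>

text \<open>\<open>K\<close> stands for the isotropy group of \<open>\<mu>\<close> and \<open>\<nu>\<close> for the restriction of \<open>\<mu>\<close> to its
  Lie algebra. That \<open>K\<close>
  fixes \<open>\<mu>\<close> is recorded as invariance of \<open>\<nu>\<close> under the adjoint action of \<open>K\<close> itself.\<close>

locale discrete_symmetry =
  fixes K :: "('g, 'm) monoid_scheme" (structure)
    and KM :: "('g, 'h::real_normed_vector) manifold"
    and Q :: "('q, 'e::real_normed_vector) manifold"
    and l :: "'g \<Rightarrow> 'q \<Rightarrow> 'q"
    and Ld :: "'q \<times> 'q \<Rightarrow> real"
    and \<nu> :: "'h \<Rightarrow> real"
    and B :: "('q set, 'b::real_normed_vector) manifold"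
    and \<AA> :: "'q \<Rightarrow> 'e \<Rightarrow> 'h"
  assumes Q: "smooth_manifold Q"
    and Ld: "smooth_map (prod_manifold Q Q) vec_manifold Ld"
    and K: "lie_group K KM"
    and act: "smooth_action K KM Q l"
    and inv_Ld: "invariant_lagrangian K Q l Ld"
    and lin: "linear \<nu>"
    and Ad_inv: "\<And>k \<xi>. k \<in> carrier K \<Longrightarrow> \<nu> (Ad K KM k \<xi>) = \<nu> \<xi>"
    and B: "quotient_principal_bundle K KM Q l B"
    and conn: "has_affine_discrete_connection K KM Q l Ld \<nu>"
    and prin: "principal_connection K KM Q l \<AA>"

sublocale discrete_symmetry \<subseteq> group K
  using K by (simp add: lie_group_def)

sublocale discrete_symmetry \<subseteq> act: group_action K "mcarrier Q" l
  using act by (simp add: smooth_action_def)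

context discrete_symmetry
begin

abbreviation "J \<equiv> momentum_map K KM Q l Ld"
abbreviation "A \<equiv> discrete_connection K KM Q l Ld \<nu>"
abbreviation "gen \<equiv> inf_gen K KM Q l"
abbreviation "level \<equiv> momentum_level K KM Q l Ld \<nu>"
abbreviation "TA q0 q1 \<equiv> tangent_map (prod_manifold Q Q) KM A (q0, q1)"
abbreviation "TL \<equiv> \<lambda>k. tangent_map Q Q (l k)"
abbreviation "T\<pi> \<equiv> tangent_map Q B (orbit K l)"
abbreviation "hlift \<equiv> horizontal_lift K Q l B \<AA>"
abbreviation "dlift \<equiv> discrete_horizontal_lift K KM Q l Ld \<nu>"

lemma KM: "smooth_manifold KM" and carrier_KM [simp]: "mcarrier KM = carrier K"
  and inv_smooth: "smooth_map KM KM (\<lambda>g. inv g)"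
  using K by (auto simp: lie_group_def)

lemma act_smooth: "smooth_map (prod_manifold KM Q) Q (\<lambda>(g, q). l g q)"
  using act by (simp add: smooth_action_def)

lemmas chQ = smooth_manifold_charted[OF Q]
lemmas chK = smooth_manifold_charted[OF KM]

lemma BM: "smooth_manifold B" and proj_smooth: "smooth_map Q B (orbit K l)"
  and carrier_B: "mcarrier B = orbits K (mcarrier Q) l"
  using B by (auto simp: quotient_principal_bundle_def)

lemmas chB = smooth_manifold_charted[OF BM]
lemmas chQQ = charted_prod[OF chQ(1) chQ(1)] open_charts_prod[OF chQ(2) chQ(2)]
lemmas chKQ = charted_prod[OF chK(1) chQ(1)] open_charts_prod[OF chK(2) chQ(2)]

lemma act_closed [simp]: "k \<in> carrier K \<Longrightarrow> q \<in> mcarrier Q \<Longrightarrow> l k q \<in> mcarrier Q"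
  using act.element_image by blast

lemma act_one [simp]: "q \<in> mcarrier Q \<Longrightarrow> l \<one> q = q"
  by (metis act.id_eq_one restrict_apply)

lemma act_mult: "k \<in> carrier K \<Longrightarrow> h \<in> carrier K \<Longrightarrow> q \<in> mcarrier Q \<Longrightarrow> l (k \<otimes> h) q = l k (l h q)"
  using act.composition_rule by blast

lemma act_inv [simp]:
  "k \<in> carrier K \<Longrightarrow> q \<in> mcarrier Q \<Longrightarrow> l (inv k) (l k q) = q"
  "k \<in> carrier K \<Longrightarrow> q \<in> mcarrier Q \<Longrightarrow> l k (l (inv k) q) = q"
  by (simp_all flip: act_mult)

lemma orbit_act: "k \<in> carrier K \<Longrightarrow> q \<in> mcarrier Q \<Longrightarrow> orbit K l (l k q) = orbit K l q"
proof -
  assume k: "k \<in> carrier K" and q: "q \<in> mcarrier Q"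
  have "l g (l k q) \<in> orbit K l q" if "g \<in> carrier K" for g
    using k q that by (auto simp: orbit_def simp flip: act_mult intro!: exI[of _ "g \<otimes> k"])
  moreover have "l g q \<in> orbit K l (l k q)" if "g \<in> carrier K" for g
    using k q that by (auto simp: orbit_def act_mult intro!: exI[of _ "g \<otimes> inv k"])
  ultimately show ?thesis unfolding orbit_def by auto
qed

lemma orbit_eqD:
  assumes "orbit K l q = orbit K l q'" "q \<in> mcarrier Q" "q' \<in> mcarrier Q"
  obtains k where "k \<in> carrier K" "q' = l k q"
  using act.orbit_refl[OF assms(3)] assms(1) unfolding orbit_def by blast

lemma act_tangent:
  assumes "k \<in> carrier K" "q \<in> mcarrier Q"
  shows "has_tangent (prod_manifold KM Q) Q (\<lambda>(g, q). l g q) (k, q)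
    (tangent_map (prod_manifold KM Q) Q (\<lambda>(g, q). l g q) (k, q))"
  using smooth_map_has_tangent[OF act_smooth chKQ(1) chQ(1)] assms by simp

lemma translate_tangent:
  assumes "k \<in> carrier K" "q \<in> mcarrier Q"
  shows "has_tangent Q Q (l k) q (TL k q)"
proof -
  have "has_tangent Q (prod_manifold KM Q) (\<lambda>q. (k, q)) q (\<lambda>v. (0, v))"
    using assms chQ chK by (intro has_tangent_Pair has_tangent_const has_tangent_id) auto
  from has_tangent_compose[OF this act_tangent[OF assms]]
  have "has_tangent Q Q (l k) q
      (\<lambda>v. tangent_map (prod_manifold KM Q) Q (\<lambda>(g, q). l g q) (k, q) (0, v))" by simp
  then show ?thesis using has_tangent_tangent_map by metis
qed

lemma orbit_map_tangent:
  assumes "q \<in> mcarrier Q"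
  shows "has_tangent KM Q (\<lambda>k. l k q) \<one> (\<lambda>\<xi>. gen \<xi> q)"
proof -
  have "has_tangent KM (prod_manifold KM Q) (\<lambda>k. (k, q)) \<one> (\<lambda>v. (v, 0))"
    using assms chQ chK by (intro has_tangent_Pair has_tangent_const has_tangent_id) auto
  from has_tangent_compose[OF this act_tangent[OF _ assms]]
  have "has_tangent KM Q (\<lambda>k. l k q) \<one>
      (\<lambda>v. tangent_map (prod_manifold KM Q) Q (\<lambda>(g, q). l g q) (\<one>, q) (v, 0))" by simp
  then show ?thesis unfolding inf_gen_def using has_tangent_tangent_map by metis
qed

text \<open>Both sides are velocities of \<open>h \<mapsto> l (k \<otimes> h \<otimes> inv k) (l k q) = l k (l h q)\<close>.\<close>

lemma gen_equivariant:
  assumes k: "k \<in> carrier K" and q: "q \<in> mcarrier Q"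
  shows "TL k q (gen \<xi> q) = gen (Ad K KM k \<xi>) (l k q)"
proof -
  have "has_tangent KM Q (\<lambda>h. l k (l h q)) \<one> (\<lambda>\<xi>. TL k q (gen \<xi> q))"
    using has_tangent_compose[OF orbit_map_tangent[OF q], of Q "l k"] translate_tangent[OF k q] q
    by simp
  then have 1: "has_tangent KM Q (\<lambda>h. l (k \<otimes> h \<otimes> inv k) (l k q)) \<one> (\<lambda>\<xi>. TL k q (gen \<xi> q))"
    by (rule has_tangent_cong) (use k q chK in \<open>auto simp: act_mult\<close>)
  have 2: "has_tangent KM Q (\<lambda>h. l (k \<otimes> h \<otimes> inv k) (l k q)) \<one>
      (\<lambda>\<xi>. gen (Ad K KM k \<xi>) (l k q))"
    using has_tangent_compose[OF Ad_tangent[OF K k], of Q "\<lambda>g. l g (l k q)"]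
      orbit_map_tangent[of "l k q"] k q by simp
  show ?thesis using has_tangent_unique_at[OF 1 2] .
qed

lemma Ld_tangent:
  assumes "q0 \<in> mcarrier Q" "q1 \<in> mcarrier Q"
  shows "has_tangent (prod_manifold Q Q) vec_manifold Ld (q0, q1)
    (tangent_map (prod_manifold Q Q) vec_manifold Ld (q0, q1))"
  using smooth_map_has_tangent[OF Ld chQQ(1) charted_vec(1)] assms by simp

lemma D1_eq:
  assumes "q0 \<in> mcarrier Q" "q1 \<in> mcarrier Q"
  shows "has_tangent Q vec_manifold (\<lambda>x. Ld (x, q1)) q0 (D1 Q Ld q0 q1)"
    and "D1 Q Ld q0 q1 v = tangent_map (prod_manifold Q Q) vec_manifold Ld (q0, q1) (v, 0)"
proof -
  have "has_tangent Q (prod_manifold Q Q) (\<lambda>x. (x, q1)) q0 (\<lambda>v. (v, 0))"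
    using assms chQ by (intro has_tangent_Pair has_tangent_const has_tangent_id) auto
  from has_tangent_compose[OF this Ld_tangent[OF assms]]
  have "has_tangent Q vec_manifold (\<lambda>x. Ld (x, q1)) q0
      (\<lambda>v. tangent_map (prod_manifold Q Q) vec_manifold Ld (q0, q1) (v, 0))" by simp
  then show "has_tangent Q vec_manifold (\<lambda>x. Ld (x, q1)) q0 (D1 Q Ld q0 q1)"
    "D1 Q Ld q0 q1 v = tangent_map (prod_manifold Q Q) vec_manifold Ld (q0, q1) (v, 0)"
    unfolding D1_def by (simp_all add: has_tangent_tangent_map)
qed

text \<open>Differentiate \<open>Ld (l k x, l k q1) = Ld (x, q1)\<close> in \<open>x\<close> along the generator at \<open>q0\<close>.\<close>

lemma momentum_map_Ad:
  assumes k: "k \<in> carrier K" and q: "q0 \<in> mcarrier Q" "q1 \<in> mcarrier Q"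
  shows "J (l k q0) (l k q1) (Ad K KM k \<xi>) = J q0 q1 \<xi>"
proof -
  have "has_tangent Q vec_manifold (\<lambda>x. Ld (l k x, l k q1)) q0
      (\<lambda>v. D1 Q Ld (l k q0) (l k q1) (TL k q0 v))"
    using has_tangent_compose[OF translate_tangent[OF k q(1)] D1_eq(1)] k q by simp
  then have "has_tangent Q vec_manifold (\<lambda>x. Ld (x, q1)) q0
      (\<lambda>v. D1 Q Ld (l k q0) (l k q1) (TL k q0 v))"
    by (rule has_tangent_cong) (use k q chQ inv_Ld in \<open>auto simp: invariant_lagrangian_def\<close>)
  from has_tangent_unique_at[OF this D1_eq(1)[OF q], of "gen \<xi> q0"]
  show ?thesis unfolding momentum_map_def using gen_equivariant[OF k q(1), of \<xi>] by simp
qed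

lemma momentum_level_act:
  assumes k: "k \<in> carrier K" and q: "q0 \<in> mcarrier Q" "q1 \<in> mcarrier Q" and J: "J q0 q1 = \<nu>"
  shows "J (l k q0) (l k q1) = \<nu>"
proof
  fix \<eta>
  have "J q0 q1 (Ad K KM (inv k) \<eta>) = J (l k q0) (l k q1) \<eta>"
    using momentum_map_Ad[of "inv k" "l k q0" "l k q1" \<eta>] k q by simp
  then show "J (l k q0) (l k q1) \<eta> = \<nu> \<eta>" using J Ad_inv[of "inv k" \<eta>] k by simp
qed

text \<open>The momentum, defined through the first factor of \<open>Ld\<close>, is also the derivative along the group
  in the second factor, because \<open>Ld\<close> is constant along \<open>k \<mapsto> (l k q0, l k q1)\<close>.\<close>

lemma Ld_tangent_vertical:
  assumes q: "q0 \<in> mcarrier Q" "q1 \<in> mcarrier Q"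
  shows "tangent_map KM vec_manifold (\<lambda>k. Ld (q0, l k q1)) \<one> \<xi> = J q0 q1 \<xi>"
proof -
  let ?D = "tangent_map (prod_manifold Q Q) vec_manifold Ld (q0, q1)"
  interpret D: linear ?D using Ld_tangent[OF q] by (rule has_tangent_linear)
  have "has_tangent KM (prod_manifold Q Q) (\<lambda>k. (l k q0, l k q1)) \<one> (\<lambda>\<xi>. (gen \<xi> q0, gen \<xi> q1))"
    using q by (intro has_tangent_Pair orbit_map_tangent)
  from has_tangent_compose[OF this, of vec_manifold Ld ?D] Ld_tangent[OF q] q
  have "has_tangent KM vec_manifold (\<lambda>k. Ld (l k q0, l k q1)) \<one> (\<lambda>\<xi>. ?D (gen \<xi> q0, gen \<xi> q1))"
    by simp
  then have "has_tangent KM vec_manifold (\<lambda>k. Ld (q0, q1)) \<one> (\<lambda>\<xi>. ?D (gen \<xi> q0, gen \<xi> q1))"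
    by (rule has_tangent_cong) (use q chK inv_Ld in \<open>auto simp: invariant_lagrangian_def\<close>)
  moreover have "has_tangent KM vec_manifold (\<lambda>k. Ld (q0, q1)) \<one> (\<lambda>\<xi>. 0)"
    by (rule has_tangent_const) (use chK charted_vec in auto)
  ultimately have "?D (gen \<xi> q0, gen \<xi> q1) = 0" by (rule has_tangent_unique_at)
  moreover have "(gen \<xi> q0, gen \<xi> q1) = (gen \<xi> q0, 0) + (0, gen \<xi> q1)" by simp
  ultimately have "?D (0, gen \<xi> q1) = - ?D (gen \<xi> q0, 0)"
    by (metis D.add add_eq_0_iff)
  then have J: "?D (0, gen \<xi> q1) = J q0 q1 \<xi>"
    using D1_eq(2)[OF q] by (simp add: momentum_map_def)
  have "has_tangent KM (prod_manifold Q Q) (\<lambda>k. (q0, l k q1)) \<one> (\<lambda>\<xi>. (0, gen \<xi> q1))"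
    using q chQ chK by (intro has_tangent_Pair orbit_map_tangent has_tangent_const) auto
  from has_tangent_compose[OF this, of vec_manifold Ld ?D] Ld_tangent[OF q] q
  have "has_tangent KM vec_manifold (\<lambda>k. Ld (q0, l k q1)) \<one> (\<lambda>\<xi>. ?D (0, gen \<xi> q1))" by simp
  then show ?thesis using has_tangent_tangent_map J by metis
qed


section \<open>The affine discrete connection\<close>

lemma A_unique:
  assumes "q0 \<in> mcarrier Q" "q1 \<in> mcarrier Q"
  shows "\<exists>!g. g \<in> carrier K \<and> J q0 (l (inv g) q1) = \<nu>"
  using conn assms by (simp add: has_affine_discrete_connection_def)

lemma A_closed [simp]: "q0 \<in> mcarrier Q \<Longrightarrow> q1 \<in> mcarrier Q \<Longrightarrow> A (q0, q1) \<in> carrier K"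
  and J_A: "q0 \<in> mcarrier Q \<Longrightarrow> q1 \<in> mcarrier Q \<Longrightarrow> J q0 (l (inv (A (q0, q1))) q1) = \<nu>"
  using theI'[OF A_unique, of q0 q1] by (simp_all add: discrete_connection_def)

lemma A_eqI:
  assumes "q0 \<in> mcarrier Q" "q1 \<in> mcarrier Q" "g \<in> carrier K" "J q0 (l (inv g) q1) = \<nu>"
  shows "A (q0, q1) = g"
  using A_unique[OF assms(1,2)] A_closed[OF assms(1,2)] J_A[OF assms(1,2)] assms(3,4) by blast

lemma A_eq_one_iff:
  assumes "q0 \<in> mcarrier Q" "q1 \<in> mcarrier Q"
  shows "A (q0, q1) = \<one> \<longleftrightarrow> J q0 q1 = \<nu>"
  using A_eqI[of q0 q1 \<one>] J_A[of q0 q1] assms by auto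

lemma A_act_right:
  assumes "k \<in> carrier K" "q0 \<in> mcarrier Q" "q1 \<in> mcarrier Q"
  shows "A (q0, l k q1) = k \<otimes> A (q0, q1)"
  using assms J_A[of q0 q1] by (intro A_eqI) (auto simp: inv_mult_group act_mult)

text \<open>By equivariance of the momentum, \<open>l k\<close> carries the point of the orbit of \<open>q1\<close> that has momentum
  \<open>\<nu>\<close> with \<open>q0\<close> to the point with the same property for \<open>l k q0\<close>.\<close>

lemma A_act_diag:
  assumes "k \<in> carrier K" "q0 \<in> mcarrier Q" "q1 \<in> mcarrier Q"
  shows "A (l k q0, l k q1) = k \<otimes> A (q0, q1) \<otimes> inv k"
proof (rule A_eqI)
  have "l (inv (k \<otimes> A (q0, q1) \<otimes> inv k)) (l k q1) = l k (l (inv (A (q0, q1))) q1)"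
    using assms by (simp add: inv_mult_group act_mult)
  then show "J (l k q0) (l (inv (k \<otimes> A (q0, q1) \<otimes> inv k)) (l k q1)) = \<nu>"
    using momentum_level_act[OF assms(1,2), of "l (inv (A (q0, q1))) q1"] J_A[of q0 q1] assms by simp
qed (use assms in auto)

lemma A_smooth: "smooth_map (prod_manifold Q Q) KM A"
  using conn by (simp add: has_affine_discrete_connection_def)

lemma A_tangent:
  assumes "q0 \<in> mcarrier Q" "q1 \<in> mcarrier Q"
  shows "has_tangent (prod_manifold Q Q) KM A (q0, q1) (TA q0 q1)"
  using smooth_map_has_tangent[OF A_smooth chQQ(1) chK(1)] assms by simp

text \<open>Where \<open>A\<close> takes the value \<open>\<one>\<close>, the map \<open>k \<mapsto> A (q0, l k q1)\<close> is the identity of \<open>K\<close>, while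
  \<open>k \<mapsto> A (l k q0, l k q1)\<close> is constant. These two facts give the derivative of \<open>A\<close> in all vertical
  directions, without differentiating the inversion of \<open>K\<close>.\<close>

lemma TA_vertical_right:
  assumes q: "q0 \<in> mcarrier Q" "q1 \<in> mcarrier Q" and J: "J q0 q1 = \<nu>"
  shows "TA q0 q1 (0, gen \<xi> q1) = \<xi>"
proof -
  have A1: "A (q0, q1) = \<one>" using q J A_eq_one_iff by simp
  have "has_tangent KM (prod_manifold Q Q) (\<lambda>k. (q0, l k q1)) \<one> (\<lambda>\<xi>. (0, gen \<xi> q1))"
    using q chQ chK by (intro has_tangent_Pair orbit_map_tangent has_tangent_const) auto
  from has_tangent_compose[OF this, of KM A "TA q0 q1"] A_tangent[OF q] q
  have "has_tangent KM KM (\<lambda>k. A (q0, l k q1)) \<one> (\<lambda>\<xi>. TA q0 q1 (0, gen \<xi> q1))" by simp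
  then have "has_tangent KM KM (\<lambda>k. k) \<one> (\<lambda>\<xi>. TA q0 q1 (0, gen \<xi> q1))"
    by (rule has_tangent_cong) (use q chK A_act_right A1 in auto)
  moreover have "has_tangent KM KM (\<lambda>k. k) \<one> (\<lambda>\<xi>. \<xi>)"
    by (rule has_tangent_id) (use chK in auto)
  ultimately show ?thesis by (rule has_tangent_unique_at)
qed

lemma TA_vertical_diag:
  assumes q: "q0 \<in> mcarrier Q" "q1 \<in> mcarrier Q" and J: "J q0 q1 = \<nu>"
  shows "TA q0 q1 (gen \<xi> q0, gen \<xi> q1) = 0"
proof -
  have A1: "A (q0, q1) = \<one>" using q J A_eq_one_iff by simp
  have "has_tangent KM (prod_manifold Q Q) (\<lambda>k. (l k q0, l k q1)) \<one> (\<lambda>\<xi>. (gen \<xi> q0, gen \<xi> q1))"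
    using q by (intro has_tangent_Pair orbit_map_tangent)
  from has_tangent_compose[OF this, of KM A "TA q0 q1"] A_tangent[OF q] q
  have "has_tangent KM KM (\<lambda>k. A (l k q0, l k q1)) \<one> (\<lambda>\<xi>. TA q0 q1 (gen \<xi> q0, gen \<xi> q1))" by simp
  then have "has_tangent KM KM (\<lambda>k. \<one>) \<one> (\<lambda>\<xi>. TA q0 q1 (gen \<xi> q0, gen \<xi> q1))"
    by (rule has_tangent_cong) (use q chK A_act_diag A1 in auto)
  moreover have "has_tangent KM KM (\<lambda>k. \<one>) \<one> (\<lambda>\<xi>. 0)"
    by (rule has_tangent_const) (use chK in auto)
  ultimately show ?thesis by (rule has_tangent_unique_at)
qed

lemma gen_linear: "q \<in> mcarrier Q \<Longrightarrow> linear (\<lambda>\<xi>. gen \<xi> q)"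
  using orbit_map_tangent by (rule has_tangent_linear)

lemma TA_vertical:
  assumes q: "q0 \<in> mcarrier Q" "q1 \<in> mcarrier Q" and J: "J q0 q1 = \<nu>"
  shows "TA q0 q1 (gen \<xi>0 q0, gen \<xi>1 q1) = \<xi>1 - \<xi>0"
proof -
  interpret linear "TA q0 q1" using A_tangent[OF q] by (rule has_tangent_linear)
  \<comment> \<open>a diagonal vertical vector plus a vertical vector in the second factor\<close>
  have "(gen \<xi>0 q0, gen \<xi>1 q1) = (gen \<xi>0 q0, gen \<xi>0 q1) + (0, gen (\<xi>1 - \<xi>0) q1)"
    using linear_diff[OF gen_linear[OF q(2)], of \<xi>1 \<xi>0] by simp
  then have "TA q0 q1 (gen \<xi>0 q0, gen \<xi>1 q1) =
      TA q0 q1 (gen \<xi>0 q0, gen \<xi>0 q1) + TA q0 q1 (0, gen (\<xi>1 - \<xi>0) q1)"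
    by (simp only: add)
  then show ?thesis by (simp only: TA_vertical_right[OF assms] TA_vertical_diag[OF assms]) simp
qed

lemma TA_equivariant:
  assumes k: "k \<in> carrier K" and q: "q0 \<in> mcarrier Q" "q1 \<in> mcarrier Q" and J: "J q0 q1 = \<nu>"
  shows "TA (l k q0) (l k q1) (TL k q0 v0, TL k q1 v1) = Ad K KM k (TA q0 q1 (v0, v1))"
proof -
  have A1: "A (q0, q1) = \<one>" using q J A_eq_one_iff by simp
  have 1: "has_tangent (prod_manifold Q Q) (prod_manifold Q Q) (\<lambda>x. (l k (fst x), l k (snd x))) (q0, q1)
      (\<lambda>v. (TL k q0 (fst v), TL k q1 (snd v)))"
    using q chQ k
      has_tangent_compose[OF has_tangent_fst[of Q q0 Q q1], of Q "l k"]
      has_tangent_compose[OF has_tangent_snd[of Q q0 Q q1], of Q "l k"]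
    by (intro has_tangent_Pair) (auto simp: translate_tangent)
  have "has_tangent (prod_manifold Q Q) KM (\<lambda>x. A (l k (fst x), l k (snd x))) (q0, q1)
      (\<lambda>v. TA (l k q0) (l k q1) (TL k q0 (fst v), TL k q1 (snd v)))"
    using has_tangent_compose[OF 1, of KM A] A_tangent[of "l k q0" "l k q1"] q k by simp
  then have "has_tangent (prod_manifold Q Q) KM (\<lambda>x. k \<otimes> A x \<otimes> inv k) (q0, q1)
      (\<lambda>v. TA (l k q0) (l k q1) (TL k q0 (fst v), TL k q1 (snd v)))"
    by (rule has_tangent_cong) (use q k chQQ A_act_diag in auto)
  moreover have "has_tangent (prod_manifold Q Q) KM (\<lambda>x. k \<otimes> A x \<otimes> inv k) (q0, q1)
      (\<lambda>v. Ad K KM k (TA q0 q1 v))"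
    using has_tangent_compose[OF A_tangent[OF q], of KM "\<lambda>h. k \<otimes> h \<otimes> inv k"] Ad_tangent[OF K k] A1 by simp
  ultimately have "(\<lambda>v. TA (l k q0) (l k q1) (TL k q0 (fst v), TL k q1 (snd v))) =
      (\<lambda>v. Ad K KM k (TA q0 q1 v))"
    by (rule has_tangent_unique)
  from fun_cong[OF this, of "(v0, v1)"] show ?thesis by simp
qed

text \<open>The discrete connection is constant along curves in the momentum level.\<close>

lemma TA_level:
  assumes q: "q0 \<in> mcarrier Q" "q1 \<in> mcarrier Q"
    and v: "v \<in> tangent_space_sub (prod_manifold Q Q) level (q0, q1)"
  shows "TA q0 q1 v = 0"
proof -
  obtain \<gamma> :: "real \<Rightarrow> 'q \<times> 'q" and \<epsilon> where \<epsilon>: "\<epsilon> > 0"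
    and sm: "smooth_map (open_submanifold vec_manifold {-\<epsilon><..<\<epsilon>}) (prod_manifold Q Q) \<gamma>"
    and lev: "\<gamma> ` {-\<epsilon><..<\<epsilon>} \<subseteq> level" and \<gamma>0: "\<gamma> 0 = (q0, q1)"
    and v: "v = tangent_map vec_manifold (prod_manifold Q Q) \<gamma> 0 1"
    using v unfolding tangent_space_sub_def by blast
  let ?I = "open_submanifold vec_manifold {-\<epsilon><..<\<epsilon>}"
  have chI: "charted ?I" by (intro charted_open_submanifold charted_vec)
  have 1: "has_tangent ?I (prod_manifold Q Q) \<gamma> 0 (tangent_map ?I (prod_manifold Q Q) \<gamma> 0)"
    by (rule smooth_map_has_tangent[OF sm chI chQQ(1)]) (use \<epsilon> in simp)
  have 1: "has_tangent ?I (prod_manifold Q Q) \<gamma> 0 (tangent_map vec_manifold (prod_manifold Q Q) \<gamma> 0)"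
    using 1 has_tangent_from_open_superset[OF 1] has_tangent_tangent_map by fastforce
  have "has_tangent ?I KM (\<lambda>t. A (\<gamma> t)) 0
      (\<lambda>v. TA q0 q1 (tangent_map vec_manifold (prod_manifold Q Q) \<gamma> 0 v))"
    using has_tangent_compose[OF 1, of KM A] A_tangent[OF q] \<gamma>0 by simp
  then have 2: "has_tangent ?I KM (\<lambda>t. \<one>) 0
      (\<lambda>v. TA q0 q1 (tangent_map vec_manifold (prod_manifold Q Q) \<gamma> 0 v))"
  proof (rule has_tangent_cong[OF _ chI])
    show "A (\<gamma> t) = \<one>" if "t \<in> mcarrier ?I" for t
    proof -
      have "\<gamma> t \<in> level" using lev that by auto
      then show ?thesis using A_eq_one_iff by (cases "\<gamma> t") (auto simp: momentum_level_def)
    qed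
  qed (use \<epsilon> in simp)
  have 3: "has_tangent vec_manifold KM (\<lambda>t. \<one>) (0::real) (\<lambda>v. 0)"
    by (rule has_tangent_const) (use charted_vec chK in auto)
  show ?thesis
    using has_tangent_unique_at[OF has_tangent_from_open_superset[OF 2] 3, of 1] v by simp
qed


section \<open>Vertical and horizontal vectors\<close>

lemma proj_tangent: "q \<in> mcarrier Q \<Longrightarrow> has_tangent Q B (orbit K l) q (T\<pi> q)"
  by (rule smooth_map_has_tangent[OF proj_smooth chQ(1) chB(1)])

lemma orbit_in_B [simp]: "q \<in> mcarrier Q \<Longrightarrow> orbit K l q \<in> mcarrier B"
  by (auto simp: carrier_B orbits_def)

lemma T\<pi>_translate:
  assumes k: "k \<in> carrier K" and q: "q \<in> mcarrier Q"
  shows "T\<pi> (l k q) (TL k q v) = T\<pi> q v"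
proof -
  have "has_tangent Q B (\<lambda>x. orbit K l (l k x)) q (\<lambda>v. T\<pi> (l k q) (TL k q v))"
    using k q by (intro has_tangent_compose[OF translate_tangent] proj_tangent) auto
  then have "has_tangent Q B (orbit K l) q (\<lambda>v. T\<pi> (l k q) (TL k q v))"
    by (rule has_tangent_cong) (use k q chQ orbit_act in auto)
  then show ?thesis using proj_tangent[OF q] by (rule has_tangent_unique_at)
qed

lemma T\<pi>_gen:
  assumes q: "q \<in> mcarrier Q"
  shows "T\<pi> q (gen \<xi> q) = 0"
proof -
  have "has_tangent KM B (\<lambda>k. orbit K l (l k q)) \<one> (\<lambda>\<xi>. T\<pi> q (gen \<xi> q))"
    using has_tangent_compose[OF orbit_map_tangent[OF q], of B "orbit K l"] proj_tangent[OF q] q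
    by simp
  then have "has_tangent KM B (\<lambda>k. orbit K l q) \<one> (\<lambda>\<xi>. T\<pi> q (gen \<xi> q))"
    by (rule has_tangent_cong) (use q chK orbit_act in auto)
  moreover have "has_tangent KM B (\<lambda>k. orbit K l q) \<one> (\<lambda>\<xi>. 0)"
    by (rule has_tangent_const) (use q chK chB in auto)
  ultimately show ?thesis by (rule has_tangent_unique_at)
qed

lemma T\<pi>_linear: "q \<in> mcarrier Q \<Longrightarrow> linear (T\<pi> q)"
  using proj_tangent by (rule has_tangent_linear)

text \<open>A local trivialization \<open>\<Psi>\<close> turns the projection into the first projection of a product, which is
  surjective on tangent vectors with kernel the vectors \<open>(0, \<eta>)\<close>. As \<open>\<Psi>\<close> turns the action into left
  multiplication, \<open>(0, \<eta>)\<close> is the image of the generator of the \<open>\<xi>\<close> whose right translate by \<open>k\<close>, the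
  group component of \<open>\<Psi> q\<close>, is \<open>\<eta>\<close>.\<close>

lemma bundle_tangent:
  assumes q: "q \<in> mcarrier Q"
  shows T\<pi>_surj: "\<exists>v. T\<pi> q v = w"
    and T\<pi>_kernel: "T\<pi> q v = 0 \<Longrightarrow> \<exists>\<xi>. v = gen \<xi> q"
proof -
  obtain U \<Psi> where U: "openin (mtopology B) U" "orbit K l q \<in> U"
    and diff: "diffeomorphism (open_submanifold Q {q\<in>mcarrier Q. orbit K l q \<in> U})
          (prod_manifold (open_submanifold B U) KM) \<Psi>"
    and all: "\<forall>q\<in>mcarrier Q. orbit K l q \<in> U \<longrightarrow> fst (\<Psi> q) = orbit K l q \<and>
           (\<forall>g\<in>carrier K. snd (\<Psi> (l g q)) = g \<otimes> snd (\<Psi> q))"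
  proof -
    have "\<forall>\<tau>\<in>mcarrier B. \<exists>U \<Psi>. openin (mtopology B) U \<and> \<tau> \<in> U \<and>
        diffeomorphism (open_submanifold Q {q\<in>mcarrier Q. orbit K l q \<in> U})
          (prod_manifold (open_submanifold B U) KM) \<Psi> \<and>
        (\<forall>q\<in>mcarrier Q. orbit K l q \<in> U \<longrightarrow> fst (\<Psi> q) = orbit K l q \<and>
           (\<forall>g\<in>carrier K. snd (\<Psi> (l g q)) = g \<otimes> snd (\<Psi> q)))"
      using B by (simp add: quotient_principal_bundle_def)
    from bspec[OF this orbit_in_B[OF q]] show thesis using that by (elim exE conjE)
  qed
  have \<Psi>: "\<And>q. q \<in> mcarrier Q \<Longrightarrow> orbit K l q \<in> U \<Longrightarrow> fst (\<Psi> q) = orbit K l q"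
      "\<And>q g. q \<in> mcarrier Q \<Longrightarrow> orbit K l q \<in> U \<Longrightarrow> g \<in> carrier K \<Longrightarrow> snd (\<Psi> (l g q)) = g \<otimes> snd (\<Psi> q)"
    using all by blast+
  define M where "M = open_submanifold Q {q\<in>mcarrier Q. orbit K l q \<in> U}"
  define N where "N = prod_manifold (open_submanifold B U) KM"
  define \<Phi> where "\<Phi> = inv_into (mcarrier M) \<Psi>"
  have M: "mcarrier M = {q\<in>mcarrier Q. orbit K l q \<in> U}" and N: "mcarrier N = (mcarrier B \<inter> U) \<times> carrier K"
    by (auto simp: M_def N_def)
  have bij: "bij_betw \<Psi> (mcarrier M) (mcarrier N)"
    and sm: "smooth_map M N \<Psi>" "smooth_map N M \<Phi>"
    using diff unfolding diffeomorphism_def M_def N_def \<Phi>_def by auto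
  have chM: "charted M" unfolding M_def by (intro charted_open_submanifold chQ)
  have chU: "charted (open_submanifold B U)" "open_charts (open_submanifold B U)"
    using chB(1) U BM by (auto intro: charted_open_submanifold open_charts_open_submanifold)
  have chN: "charted N" unfolding N_def by (intro charted_prod chU chK)
  have qM: "q \<in> mcarrier M" using q U M by simp
  have \<Psi>q: "\<Psi> q \<in> mcarrier N" using bij qM by (auto simp: bij_betw_def)
  have \<Phi>\<Psi>: "\<Phi> (\<Psi> x) = x" if "x \<in> mcarrier M" for x
    using bij that by (simp add: \<Phi>_def bij_betw_def)
  have \<Psi>\<Phi>: "\<Psi> (\<Phi> z) = z" "\<Phi> z \<in> mcarrier M" if "z \<in> mcarrier N" for z
    using bij that by (auto simp: \<Phi>_def bij_betw_def f_inv_into_f inv_into_into)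
  define k where "k = snd (\<Psi> q)"
  have k: "k \<in> carrier K" and \<Psi>q_eq: "\<Psi> q = (orbit K l q, k)"
    using \<Psi>q N \<Psi>(1)[OF q U(2)] by (auto simp: k_def prod_eq_iff)
  note at = charted_atI[OF chQ(1) q]
  define D where "D = tangent_map M N \<Psi> q"
  define E where "E = tangent_map N M \<Phi> (\<Psi> q)"
  have D: "has_tangent M N \<Psi> q D"
    unfolding D_def by (rule smooth_map_has_tangent[OF sm(1) chM chN qM])
  have E: "has_tangent N M \<Phi> (\<Psi> q) E"
    unfolding E_def by (rule smooth_map_has_tangent[OF sm(2) chN chM \<Psi>q])
  have DQ: "has_tangent Q N \<Psi> q D"
    using D at unfolding M_def by (rule has_tangent_from_open_superset)
  have EQ: "has_tangent N Q \<Phi> (\<Psi> q) E"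
    using E unfolding M_def by (rule has_tangent_to_open_superset) (simp add: \<Phi>\<Psi>[OF qM] at)
  have "has_tangent M Q (\<lambda>x. \<Phi> (\<Psi> x)) q (\<lambda>v. E (D v))" using D EQ by (rule has_tangent_compose)
  then have "has_tangent M Q (\<lambda>x. x) q (\<lambda>v. E (D v))"
    by (rule has_tangent_cong[OF _ chM qM]) (rule \<Phi>\<Psi>)
  then have "has_tangent Q Q (\<lambda>x. x) q (\<lambda>v. E (D v))"
    using at unfolding M_def by (rule has_tangent_from_open_superset)
  then have ED: "E (D v) = v" for v
    using has_tangent_id[OF chQ(1,2) q] by (rule has_tangent_unique_at)
  have fstN: "has_tangent N B fst (\<Psi> q) fst"
  proof -
    have "has_tangent N (open_submanifold B U) fst (\<Psi> q) fst"
      unfolding N_def \<Psi>q_eq by (rule has_tangent_fst) (use chU chK k q U in auto)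
    then show ?thesis
      by (rule has_tangent_to_open_superset) (use q chB in \<open>auto simp: \<Psi>q_eq intro: charted_atI\<close>)
  qed
  have "has_tangent M B (\<lambda>x. fst (\<Psi> x)) q (\<lambda>v. fst (D v))"
    using D fstN by (rule has_tangent_compose)
  then have "has_tangent M B (orbit K l) q (\<lambda>v. fst (D v))"
    by (rule has_tangent_cong[OF _ chM qM]) (use M \<Psi> in auto)
  then have "has_tangent Q B (orbit K l) q (\<lambda>v. fst (D v))"
    using at unfolding M_def by (rule has_tangent_from_open_superset)
  then have T\<pi>: "T\<pi> q v = fst (D v)" for v
    using has_tangent_unique_at[OF proj_tangent[OF q]] by blast
  have "has_tangent N B (\<lambda>z. orbit K l (\<Phi> z)) (\<Psi> q) (\<lambda>z. T\<pi> q (E z))"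
    using has_tangent_compose[OF EQ, of B "orbit K l"] proj_tangent[OF q] \<Phi>\<Psi>[OF qM] by simp
  then have "has_tangent N B fst (\<Psi> q) (\<lambda>z. T\<pi> q (E z))"
    by (rule has_tangent_cong[OF _ chN \<Psi>q]) (use \<Psi>\<Phi> \<Psi>(1) M in fastforce)
  from has_tangent_unique_at[OF this fstN, of "(w, 0)"] have "T\<pi> q (E (w, 0)) = w" by simp
  then show "\<exists>v. T\<pi> q v = w" by auto
  assume v: "T\<pi> q v = 0"
  define R where "R = tangent_map KM KM (\<lambda>g. g \<otimes> k) \<one>"
  define R' where "R' = tangent_map KM KM (\<lambda>g. g \<otimes> inv k) k"
  have R: "has_tangent KM KM (\<lambda>g. g \<otimes> k) \<one> R"
    unfolding R_def by (rule lie_group_right_mult_tangent[OF K]) (use k in auto)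
  have R': "has_tangent KM KM (\<lambda>g. g \<otimes> inv k) k R'"
    unfolding R'_def by (rule lie_group_right_mult_tangent[OF K]) (use k in auto)
  have "has_tangent KM KM (\<lambda>g. g \<otimes> inv k \<otimes> k) k (\<lambda>\<eta>. R (R' \<eta>))"
    using has_tangent_compose[OF R', of KM "\<lambda>g. g \<otimes> k"] R k by simp
  then have "has_tangent KM KM (\<lambda>g. g) k (\<lambda>\<eta>. R (R' \<eta>))"
    by (rule has_tangent_cong) (use chK k in \<open>auto simp: m_assoc\<close>)
  moreover have "has_tangent KM KM (\<lambda>g. g) k (\<lambda>\<eta>. \<eta>)"
    by (rule has_tangent_id) (use chK k in auto)
  ultimately have RR': "R (R' \<eta>) = \<eta>" for \<eta> by (rule has_tangent_unique_at)
  have "has_tangent KM N (\<lambda>g. \<Psi> (l g q)) \<one> (\<lambda>\<xi>. D (gen \<xi> q))"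
    using has_tangent_compose[OF orbit_map_tangent[OF q], of N \<Psi>] DQ q by simp
  then have "has_tangent KM N (\<lambda>g. (orbit K l q, g \<otimes> k)) \<one> (\<lambda>\<xi>. D (gen \<xi> q))"
    by (rule has_tangent_cong) (use chK q U \<Psi> k in \<open>auto simp: orbit_act k_def prod_eq_iff\<close>)
  moreover have "has_tangent KM N (\<lambda>g. (orbit K l q, g \<otimes> k)) \<one> (\<lambda>\<xi>. (0, R \<xi>))"
    unfolding N_def by (intro has_tangent_Pair R has_tangent_const) (use chK chU q U in auto)
  ultimately have "D (gen (R' (snd (D v))) q) = (0, R (R' (snd (D v))))" by (rule has_tangent_unique_at)
  also have "\<dots> = D v" using v T\<pi> by (simp add: RR' prod_eq_iff)
  finally show "\<exists>\<xi>. v = gen \<xi> q" by (metis ED)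
qed

lemma \<AA>_linear: "q \<in> mcarrier Q \<Longrightarrow> linear (\<AA> q)"
  and \<AA>_gen: "q \<in> mcarrier Q \<Longrightarrow> \<AA> q (gen \<xi> q) = \<xi>"
  and \<AA>_translate: "k \<in> carrier K \<Longrightarrow> q \<in> mcarrier Q \<Longrightarrow> \<AA> (l k q) (TL k q v) = Ad K KM k (\<AA> q v)"
  using prin by (auto simp: principal_connection_def)

lemma hlift_ex1:
  assumes q: "q \<in> mcarrier Q"
  shows "\<exists>!v. \<AA> q v = 0 \<and> T\<pi> q v = w"
proof (rule ex_ex1I)
  obtain v where v: "T\<pi> q v = w" using T\<pi>_surj[OF q] by blast
  have "\<AA> q (v - gen (\<AA> q v) q) = 0" "T\<pi> q (v - gen (\<AA> q v) q) = w"
    using linear_diff[OF \<AA>_linear[OF q], of v "gen (\<AA> q v) q"]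
      linear_diff[OF T\<pi>_linear[OF q], of v "gen (\<AA> q v) q"]
      \<AA>_gen[OF q] T\<pi>_gen[OF q] v by simp_all
  then show "\<exists>v. \<AA> q v = 0 \<and> T\<pi> q v = w" by blast
next
  fix v v' assume v: "\<AA> q v = 0 \<and> T\<pi> q v = w" and v': "\<AA> q v' = 0 \<and> T\<pi> q v' = w"
  have "T\<pi> q (v - v') = 0" using v v' linear_diff[OF T\<pi>_linear[OF q], of v v'] by simp
  then obtain \<xi> where \<xi>: "v - v' = gen \<xi> q" using T\<pi>_kernel[OF q] by blast
  have "\<AA> q (v - v') = 0" using v v' linear_diff[OF \<AA>_linear[OF q], of v v'] by simp
  then have "\<xi> = 0" using \<AA>_gen[OF q] \<xi> by simp
  then show "v = v'" using \<xi> linear_0[OF gen_linear[OF q]] by simp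
qed

lemma hlift:
  assumes q: "q \<in> mcarrier Q"
  shows "\<AA> q (hlift q w) = 0" "T\<pi> q (hlift q w) = w"
  using theI'[OF hlift_ex1[OF q, of w]] unfolding horizontal_lift_def by auto

lemma hlift_eqI: "q \<in> mcarrier Q \<Longrightarrow> \<AA> q v = 0 \<Longrightarrow> T\<pi> q v = w \<Longrightarrow> hlift q w = v"
  using hlift_ex1[of q w] hlift[of q w] by blast

lemma hlift_decompose:
  assumes q: "q \<in> mcarrier Q"
  shows "v = hlift q (T\<pi> q v) + gen (\<AA> q v) q"
proof -
  have "hlift q (T\<pi> q v) = v - gen (\<AA> q v) q"
    using linear_diff[OF \<AA>_linear[OF q], of v "gen (\<AA> q v) q"]
      linear_diff[OF T\<pi>_linear[OF q], of v "gen (\<AA> q v) q"]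
      \<AA>_gen[OF q] T\<pi>_gen[OF q] by (intro hlift_eqI[OF q]) simp_all
  then show ?thesis by simp
qed

lemma hlift_linear:
  assumes q: "q \<in> mcarrier Q"
  shows "linear (hlift q)"
proof (rule linearI)
  show "hlift q (w + w') = hlift q w + hlift q w'" for w w'
    by (rule hlift_eqI[OF q])
      (simp_all add: hlift[OF q] linear_add[OF \<AA>_linear[OF q]] linear_add[OF T\<pi>_linear[OF q]])
  show "hlift q (c *\<^sub>R w) = c *\<^sub>R hlift q w" for c w
    by (rule hlift_eqI[OF q])
      (simp_all add: hlift[OF q] linear_scale[OF \<AA>_linear[OF q]] linear_scale[OF T\<pi>_linear[OF q]])
qed

lemma hlift_translate:
  assumes k: "k \<in> carrier K" and q: "q \<in> mcarrier Q"
  shows "hlift (l k q) w = TL k q (hlift q w)"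
proof (rule hlift_eqI)
  show "\<AA> (l k q) (TL k q (hlift q w)) = 0"
    using \<AA>_translate[OF k q] hlift[OF q] linear_0[OF has_tangent_linear[OF Ad_tangent[OF K k]]] by simp
  show "T\<pi> (l k q) (TL k q (hlift q w)) = w"
    using T\<pi>_translate[OF k q] hlift[OF q] by simp
qed (use k q in simp)


section \<open>The force and the descended connection form\<close>

lemma level_point:
  assumes "q0 \<in> mcarrier Q" "\<tau>1 \<in> mcarrier B"
  obtains q1 where "q1 \<in> mcarrier Q" "orbit K l q1 = \<tau>1" "J q0 q1 = \<nu>"
proof -
  obtain q where q: "q \<in> mcarrier Q" "\<tau>1 = orbit K l q"
    using assms(2) by (auto simp: carrier_B orbits_def)
  show thesis
    by (rule that[of "l (inv (A (q0, q))) q"]) (use q assms(1) J_A orbit_act in auto)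
qed

text \<open>Two points of an orbit with momentum \<open>\<nu>\<close> differ by a \<open>k\<close> for which \<open>A_act_right\<close> reads
  \<open>\<one> = k \<otimes> \<one>\<close>.\<close>

lemma dlift_eq:
  assumes q: "q0 \<in> mcarrier Q" "q1 \<in> mcarrier Q" and J: "J q0 q1 = \<nu>"
  shows "dlift q0 (orbit K l q1) = q1"
  unfolding discrete_horizontal_lift_def
proof (rule the_equality)
  fix q assume q': "q \<in> mcarrier Q \<and> orbit K l q = orbit K l q1 \<and> J q0 q = \<nu>"
  then obtain k where k: "k \<in> carrier K" "q = l k q1"
    using orbit_eqD[of q1 q] q(2) by auto
  have "A (q0, q) = \<one>" "A (q0, q1) = \<one>" using q q' J A_eq_one_iff by auto
  then have "k = \<one>" using A_act_right[OF k(1) q] k by simp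
  then show "q = q1" using k q by simp
qed (use q J in simp)

text \<open>The derivative of the Lagrangian along the group is the momentum, which is \<open>\<nu>\<close> on the level.\<close>

lemma force_eq:
  assumes q: "q0 \<in> mcarrier Q" "q1 \<in> mcarrier Q" and J: "J q0 q1 = \<nu>"
  shows "f_breve_at K KM Q l Ld \<nu> B \<AA> q0 (orbit K l q1) (w0, w1) =
    \<nu> (TA q0 q1 (hlift q0 w0, hlift q1 w1))"
  unfolding f_breve_at_def L_check_def Let_def
  using dlift_eq[OF assms] Ld_tangent_vertical[OF q] J by simp

text \<open>Moving \<open>q0\<close> within its orbit by \<open>k\<close> moves the discrete and the tangent horizontal lifts by \<open>k\<close> and
  hence changes the Lie algebra element in \<open>force_eq\<close> by \<open>Ad k\<close>, under which \<open>\<nu>\<close> is invariant. The force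
  therefore depends on the orbit only.\<close>

lemma force_invariant:
  assumes k: "k \<in> carrier K" and q: "q0 \<in> mcarrier Q" "q1 \<in> mcarrier Q" and J: "J q0 q1 = \<nu>"
  shows "f_breve_at K KM Q l Ld \<nu> B \<AA> (l k q0) (orbit K l q1) =
    f_breve_at K KM Q l Ld \<nu> B \<AA> q0 (orbit K l q1)"
proof
  fix w :: "'b \<times> 'b"
  obtain w0 w1 where w: "w = (w0, w1)" by fastforce
  have "f_breve_at K KM Q l Ld \<nu> B \<AA> (l k q0) (orbit K l (l k q1)) (w0, w1) =
      \<nu> (TA (l k q0) (l k q1) (hlift (l k q0) w0, hlift (l k q1) w1))"
    by (rule force_eq) (use k q momentum_level_act[OF k q J] in auto)
  also have "\<dots> = \<nu> (TA q0 q1 (hlift q0 w0, hlift q1 w1))"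
    using hlift_translate[OF k] TA_equivariant[OF k q J] Ad_inv[OF k] q by simp
  also have "\<dots> = f_breve_at K KM Q l Ld \<nu> B \<AA> q0 (orbit K l q1) (w0, w1)"
    using force_eq[OF q J] by simp
  finally show "f_breve_at K KM Q l Ld \<nu> B \<AA> (l k q0) (orbit K l q1) w =
      f_breve_at K KM Q l Ld \<nu> B \<AA> q0 (orbit K l q1) w"
    unfolding w using orbit_act[OF k q(2)] by simp
qed

lemma A_script_eq:
  assumes q: "q0 \<in> mcarrier Q" "q1 \<in> mcarrier Q"
  shows "A_script Q \<nu> \<AA> (q0, q1) (v0, v1) = \<nu> (\<AA> q1 v1) - \<nu> (\<AA> q0 v0)"
  unfolding A_script_def pullback_form_def connection_form_def
  using has_tangent_tangent_map[OF has_tangent_fst[OF chQ(1,2) q(1) chQ(1,2) q(2)]]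
    has_tangent_tangent_map[OF has_tangent_snd[OF chQ(1,2) q(1) chQ(1,2) q(2)]] by simp

text \<open>Split each component of a vector tangent to the level into its horizontal and its vertical part.
  The derivative of \<open>A\<close> kills the whole vector and is known on the vertical part, which determines it on
  the horizontal part.\<close>

lemma force_on_level:
  assumes q: "q0 \<in> mcarrier Q" "q1 \<in> mcarrier Q" and J: "J q0 q1 = \<nu>"
    and v: "(v0, v1) \<in> tangent_space_sub (prod_manifold Q Q) level (q0, q1)"
  shows "f_breve_at K KM Q l Ld \<nu> B \<AA> q0 (orbit K l q1) (T\<pi> q0 v0, T\<pi> q1 v1) =
    - A_script Q \<nu> \<AA> (q0, q1) (v0, v1)"
proof -
  let ?h = "(hlift q0 (T\<pi> q0 v0), hlift q1 (T\<pi> q1 v1))" and ?x = "(gen (\<AA> q0 v0) q0, gen (\<AA> q1 v1) q1)"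
  have "(v0, v1) = ?h + ?x" using hlift_decompose q by simp
  then have "TA q0 q1 ?h + TA q0 q1 ?x = TA q0 q1 (v0, v1)"
    using linear_add[OF has_tangent_linear[OF A_tangent[OF q]], of ?h ?x] by (simp only:)
  also have "\<dots> = 0" using TA_level[OF q v] .
  finally have "TA q0 q1 ?h = \<AA> q0 v0 - \<AA> q1 v1"
    unfolding TA_vertical[OF q J] by (simp add: algebra_simps)
  then show ?thesis
    using force_eq[OF q J] A_script_eq[OF q] linear_diff[OF lin] by simp
qed

text \<open>Start from curves with arbitrary velocities in both factors and correct the second one along its
  fibre by the inverse of \<open>A\<close>: this enforces momentum \<open>\<nu>\<close> and does not change the projections.
  Consequently a covector is determined by its values on the projections of vectors tangent to the
  level.\<close>

lemma level_tangent_surj: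
  assumes q: "q0 \<in> mcarrier Q" "q1 \<in> mcarrier Q" and J: "J q0 q1 = \<nu>"
  obtains v0 v1 where "(v0, v1) \<in> tangent_space_sub (prod_manifold Q Q) level (q0, q1)"
    "T\<pi> q0 v0 = w0" "T\<pi> q1 v1 = w1"
proof -
  obtain u0 u1 where u: "T\<pi> q0 u0 = w0" "T\<pi> q1 u1 = w1"
    using T\<pi>_surj[OF q(1)] T\<pi>_surj[OF q(2)] by blast
  obtain \<gamma>0 \<epsilon>0 where \<gamma>0: "\<epsilon>0 > 0" "\<gamma>0 0 = q0"
    "smooth_map (open_submanifold vec_manifold {-\<epsilon>0<..<\<epsilon>0::real}) Q \<gamma>0"
    "has_tangent vec_manifold Q \<gamma>0 0 (\<lambda>t. t *\<^sub>R u0)"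
    using straight_curve[OF Q q(1)] by blast
  obtain \<gamma>1 \<epsilon>1 where \<gamma>1: "\<epsilon>1 > 0" "\<gamma>1 0 = q1"
    "smooth_map (open_submanifold vec_manifold {-\<epsilon>1<..<\<epsilon>1::real}) Q \<gamma>1"
    "has_tangent vec_manifold Q \<gamma>1 0 (\<lambda>t. t *\<^sub>R u1)"
    using straight_curve[OF Q q(2)] by blast
  define \<epsilon> where "\<epsilon> = min \<epsilon>0 \<epsilon>1"
  have \<epsilon>: "\<epsilon> > 0" using \<gamma>0 \<gamma>1 by (simp add: \<epsilon>_def)
  define I where "I = open_submanifold vec_manifold {-\<epsilon><..<\<epsilon>}"
  have I: "mcarrier I = {-\<epsilon><..<\<epsilon>}" "0 \<in> mcarrier I" and chI: "charted I"
    using \<epsilon> by (auto simp: I_def intro: charted_open_submanifold charted_vec)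
  have s: "smooth_map I Q \<gamma>0" "smooth_map I Q \<gamma>1"
    unfolding I_def by (rule smooth_curve_restrict[OF \<gamma>0(3)], auto simp: \<epsilon>_def)
      (rule smooth_curve_restrict[OF \<gamma>1(3)], auto simp: \<epsilon>_def)
  have \<gamma>Q: "\<gamma>0 t \<in> mcarrier Q" "\<gamma>1 t \<in> mcarrier Q" if "t \<in> mcarrier I" for t
    using s that by (auto simp: smooth_map_def)
  define a where "a t = inv (A (\<gamma>0 t, \<gamma>1 t))" for t
  define c where "c t = (\<gamma>0 t, l (a t) (\<gamma>1 t))" for t
  have "smooth_map I (prod_manifold Q Q) (\<lambda>t. (\<gamma>0 t, \<gamma>1 t))" using s chI by (rule smooth_map_Pair)
  then have "smooth_map I KM (\<lambda>t. A (\<gamma>0 t, \<gamma>1 t))"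
    by (rule smooth_map_compose[OF _ A_smooth chI chQQ(1) finite_dimensional_prod[OF chQ(3) chQ(3)]])
  then have "smooth_map I KM a"
    unfolding a_def by (rule smooth_map_compose[OF _ inv_smooth chI chK(1) chK(3)])
  then have "smooth_map I (prod_manifold KM Q) (\<lambda>t. (a t, \<gamma>1 t))" using s(2) chI by (rule smooth_map_Pair)
  from smooth_map_compose[OF this act_smooth chI chKQ(1) finite_dimensional_prod[OF chK(3) chQ(3)]]
  have "smooth_map I Q (\<lambda>t. l (a t) (\<gamma>1 t))" by simp
  with s(1) have sc: "smooth_map I (prod_manifold Q Q) c"
    unfolding c_def using chI by (rule smooth_map_Pair)
  have ac: "a t \<in> carrier K" if "t \<in> mcarrier I" for t using \<gamma>Q[OF that] by (simp add: a_def)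
  have lev: "c ` {-\<epsilon><..<\<epsilon>} \<subseteq> level"
    using \<gamma>Q J_A ac unfolding I(1) by (auto simp: c_def momentum_level_def a_def)
  have c0: "c 0 = (q0, q1)"
    using \<gamma>0(2) \<gamma>1(2) A_eq_one_iff[OF q] J q by (simp add: c_def a_def)
  define V where "V = tangent_map vec_manifold (prod_manifold Q Q) c 0"
  have V: "has_tangent I (prod_manifold Q Q) c 0 V"
    using smooth_map_has_tangent[OF sc chI chQQ(1) I(2)] unfolding V_def I_def
    by (rule has_tangent_open_submanifold) simp
  have "has_tangent I Q \<gamma>0 0 (tangent_map vec_manifold Q \<gamma>0 0)"
    using smooth_map_has_tangent[OF s(1) chI chQ(1) I(2)] unfolding I_def
    by (rule has_tangent_open_submanifold) simp
  moreover have "has_tangent I Q \<gamma>1 0 (tangent_map vec_manifold Q \<gamma>1 0)"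
    using smooth_map_has_tangent[OF s(2) chI chQ(1) I(2)] unfolding I_def
    by (rule has_tangent_open_submanifold) simp
  ultimately have G: "has_tangent I Q \<gamma>0 0 (\<lambda>t. t *\<^sub>R u0)" "has_tangent I Q \<gamma>1 0 (\<lambda>t. t *\<^sub>R u1)"
    using has_tangent_tangent_map[OF \<gamma>0(4)] has_tangent_tangent_map[OF \<gamma>1(4)] by simp_all
  have f: "has_tangent I B (\<lambda>t. orbit K l (fst (c t))) 0 (\<lambda>t. T\<pi> q0 (fst (V t)))"
  proof -
    have "has_tangent I Q (\<lambda>t. fst (c t)) 0 (\<lambda>t. fst (V t))"
      by (rule has_tangent_compose[OF V]) (use c0 q chQ in \<open>auto intro: has_tangent_fst\<close>)
    from has_tangent_compose[OF this, of B "orbit K l"] show ?thesis using c0 proj_tangent[OF q(1)] by simp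
  qed
  have g: "has_tangent I B (\<lambda>t. orbit K l (snd (c t))) 0 (\<lambda>t. T\<pi> q1 (snd (V t)))"
  proof -
    have "has_tangent I Q (\<lambda>t. snd (c t)) 0 (\<lambda>t. snd (V t))"
      by (rule has_tangent_compose[OF V]) (use c0 q chQ in \<open>auto intro: has_tangent_snd\<close>)
    from has_tangent_compose[OF this, of B "orbit K l"] show ?thesis using c0 proj_tangent[OF q(2)] by simp
  qed
  have f': "has_tangent I B (\<lambda>t. orbit K l (fst (c t))) 0 (\<lambda>t. T\<pi> q0 (t *\<^sub>R u0))"
    using has_tangent_compose[OF G(1), of B "orbit K l"] \<gamma>0(2) proj_tangent[OF q(1)] by (simp add: c_def)
  have g': "has_tangent I B (\<lambda>t. orbit K l (snd (c t))) 0 (\<lambda>t. T\<pi> q1 (t *\<^sub>R u1))"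
  proof (rule has_tangent_cong[OF _ chI I(2)])
    show "has_tangent I B (\<lambda>t. orbit K l (\<gamma>1 t)) 0 (\<lambda>t. T\<pi> q1 (t *\<^sub>R u1))"
      using has_tangent_compose[OF G(2), of B "orbit K l"] \<gamma>1(2) proj_tangent[OF q(2)] by simp
  qed (use \<gamma>Q ac in \<open>auto simp: c_def orbit_act\<close>)
  have "T\<pi> q0 (fst (V 1)) = w0" "T\<pi> q1 (snd (V 1)) = w1"
    using has_tangent_unique_at[OF f f', of 1] has_tangent_unique_at[OF g g', of 1] u by simp_all
  moreover have "(fst (V 1), snd (V 1)) \<in> tangent_space_sub (prod_manifold Q Q) level (q0, q1)"
    using \<epsilon> sc lev c0 unfolding tangent_space_sub_def V_def I_def by auto
  ultimately show thesis using that by blast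
qed

text \<open>Both sides are given by description operators. \<open>force_invariant\<close> makes the one in the force
  well-defined and shows that minus the force satisfies the condition defining the descended form at all
  representatives; \<open>level_tangent_surj\<close> gives uniqueness.\<close>

theorem force_eq_minus_A_breve:
  assumes "\<tau>0 \<in> mcarrier B" "\<tau>1 \<in> mcarrier B"
  shows "f_breve K KM Q l Ld \<nu> B \<AA> (\<tau>0, \<tau>1) w = - A_breve K KM Q l Ld \<nu> B \<AA> (\<tau>0, \<tau>1) w"
proof -
  let ?f = "\<lambda>q. f_breve_at K KM Q l Ld \<nu> B \<AA> q \<tau>1"
  obtain q0 where q0: "q0 \<in> mcarrier Q" and \<tau>0: "\<tau>0 = orbit K l q0"
    using assms(1) by (auto simp: carrier_B orbits_def)
  obtain q1 where q1: "q1 \<in> mcarrier Q" "J q0 q1 = \<nu>" and \<tau>1: "orbit K l q1 = \<tau>1"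
    using level_point[OF q0 assms(2)] by blast
  have indep: "?f p = ?f q0" if p: "p \<in> mcarrier Q" "orbit K l p = \<tau>0" for p
  proof -
    obtain k where k: "k \<in> carrier K" "p = l k q0"
      using orbit_eqD[of q0 p] p q0 \<tau>0 by metis
    then show ?thesis using force_invariant[OF k(1) q0 q1] \<tau>1 by simp
  qed
  have "f_breve K KM Q l Ld \<nu> B \<AA> (\<tau>0, \<tau>1) = ?f q0"
  proof -
    have "(THE \<alpha>. \<forall>q\<in>mcarrier Q. orbit K l q = \<tau>0 \<longrightarrow> \<alpha> = ?f q) = ?f q0"
    proof (rule the_equality)
      show "\<forall>q\<in>mcarrier Q. orbit K l q = \<tau>0 \<longrightarrow> ?f q0 = ?f q" using indep[symmetric] by blast
    qed (use q0 \<tau>0 in blast)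
    then show ?thesis by (simp add: f_breve_def)
  qed
  moreover have "A_breve K KM Q l Ld \<nu> B \<AA> (\<tau>0, \<tau>1) = (\<lambda>w. - ?f q0 w)"
  proof -
    define P where "P \<alpha> \<longleftrightarrow> linear \<alpha> \<and>
        (\<forall>(p0, p1)\<in>level. orbit K l p0 = \<tau>0 \<longrightarrow> orbit K l p1 = \<tau>1 \<longrightarrow>
          (\<forall>(\<delta>0, \<delta>1)\<in>tangent_space_sub (prod_manifold Q Q) level (p0, p1).
            \<alpha> (T\<pi> p0 \<delta>0, T\<pi> p1 \<delta>1) = A_script Q \<nu> \<AA> (p0, p1) (\<delta>0, \<delta>1)))" for \<alpha> :: "'b \<times> 'b \<Rightarrow> real"
    have f: "?f q0 = (\<lambda>w. \<nu> (TA q0 q1 (hlift q0 (fst w), hlift q1 (snd w))))"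
      using force_eq[OF q0 q1] \<tau>1 by (auto simp: fun_eq_iff)
    have "linear (\<lambda>w. (hlift q0 (fst w), hlift q1 (snd w)))"
      using hlift_linear[OF q0] hlift_linear[OF q1(1)]
      by (auto intro!: linearI simp: linear_add linear_scale)
    from linear_compose[OF linear_compose[OF this has_tangent_linear[OF A_tangent[OF q0 q1(1)]]] lin]
    have "linear (?f q0)" unfolding f comp_def .
    then have "linear (\<lambda>w. - ?f q0 w)" by (rule linear_compose_neg)
    moreover have "- ?f q0 (T\<pi> p0 \<delta>0, T\<pi> p1 \<delta>1) = A_script Q \<nu> \<AA> (p0, p1) (\<delta>0, \<delta>1)"
      if p: "(p0, p1) \<in> level" "orbit K l p0 = \<tau>0" "orbit K l p1 = \<tau>1"
        and \<delta>: "(\<delta>0, \<delta>1) \<in> tangent_space_sub (prod_manifold Q Q) level (p0, p1)" for p0 p1 \<delta>0 \<delta>1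
    proof -
      have pQ: "p0 \<in> mcarrier Q" "p1 \<in> mcarrier Q" "J p0 p1 = \<nu>"
        using p(1) by (auto simp: momentum_level_def)
      show ?thesis
        using force_on_level[OF pQ \<delta>] indep[OF pQ(1) p(2)] p(3) by simp
    qed
    ultimately have P: "P (\<lambda>w. - ?f q0 w)" unfolding P_def by fast
    have "\<alpha> = (\<lambda>w. - ?f q0 w)" if \<alpha>: "P \<alpha>" for \<alpha>
    proof
      fix w :: "'b \<times> 'b"
      obtain v0 v1 where v: "(v0, v1) \<in> tangent_space_sub (prod_manifold Q Q) level (q0, q1)"
        and w: "T\<pi> q0 v0 = fst w" "T\<pi> q1 v1 = snd w"
        using level_tangent_surj[OF q0 q1] by blast
      have "(q0, q1) \<in> level" using q0 q1 by (simp add: momentum_level_def)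
      then have "\<alpha> (T\<pi> q0 v0, T\<pi> q1 v1) = A_script Q \<nu> \<AA> (q0, q1) (v0, v1)"
        using \<alpha> v \<tau>0 \<tau>1 unfolding P_def by fast
      then show "\<alpha> w = - ?f q0 w"
        using force_on_level[OF q0 q1 v] w \<tau>1 by simp
    qed
    with P have "(THE \<alpha>. P \<alpha>) = (\<lambda>w. - ?f q0 w)" by (rule the_equality)
    then show ?thesis unfolding A_breve_def P_def by simp
  qed
  ultimately show ?thesis by simp
qed

end

section \<open>Restriction to the coadjoint isotropy group\<close>

text \<open>The inclusion intertwines the conjugations by \<open>k\<close>. This is what makes \<open>\<mu>\<close>, restricted to the Lie
  algebra of its isotropy group, invariant under the adjoint action of that group.\<close>

lemma tangent_inclusion_Ad:
  fixes G :: "('g, 'm) monoid_scheme" (structure)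
  assumes G: "lie_group G GM" and H: "embedded_lie_subgroup G GM H HM" and k: "k \<in> H"
  shows "tangent_map HM GM (\<lambda>g. g) \<one> (Ad (G\<lparr>carrier := H\<rparr>) HM k \<xi>) =
    Ad G GM k (tangent_map HM GM (\<lambda>g. g) \<one> \<xi>)"
proof -
  let ?K = "G\<lparr>carrier := H\<rparr>" and ?T = "tangent_map HM GM (\<lambda>g. g) \<one>"
  interpret group G using lie_group_manifold[OF G] by simp
  have sub: "subgroup H G" and K: "lie_group ?K HM" and \<iota>: "smooth_map HM GM (\<lambda>g. g)"
    using H by (auto simp: embedded_lie_subgroup_def)
  note HM = lie_group_manifold[OF K] and GM = lie_group_manifold[OF G]
  have inv: "inv\<^bsub>?K\<^esub> k = inv k" using m_inv_consistent[OF sub k] .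
  have one: "\<one> \<in> H" using sub by (rule subgroup.one_closed)
  have T: "has_tangent HM GM (\<lambda>g. g) \<one> ?T"
    by (rule smooth_map_has_tangent[OF \<iota> HM(1) GM(1)]) (use HM(3) one in simp)
  have kG: "k \<in> carrier G" using sub k subgroup.mem_carrier by fast
  have AdK: "has_tangent HM HM (\<lambda>h. k \<otimes> h \<otimes> inv k) \<one> (Ad ?K HM k)"
    using Ad_tangent[OF K, of k] k inv by simp
  have "has_tangent HM GM (\<lambda>h. k \<otimes> h \<otimes> inv k) \<one> (\<lambda>\<xi>. ?T (Ad ?K HM k \<xi>))"
    using has_tangent_compose[OF AdK, of GM "\<lambda>g. g"] T kG by simp
  moreover have "has_tangent HM GM (\<lambda>h. k \<otimes> h \<otimes> inv k) \<one> (\<lambda>\<xi>. Ad G GM k (?T \<xi>))"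
    using has_tangent_compose[OF T Ad_tangent[OF G kG]] by simp
  ultimately show ?thesis by (rule has_tangent_unique_at)
qed

lemma smooth_action_subgroup:
  fixes G :: "('g, 'm) monoid_scheme" and GM :: "('g, 'l::real_normed_vector) manifold"
    and HM :: "('g, 'h::real_normed_vector) manifold" and Q :: "('q, 'e::real_normed_vector) manifold"
  assumes G: "lie_group G GM" and H: "embedded_lie_subgroup G GM H HM"
    and Q: "smooth_manifold Q" and act: "smooth_action G GM Q l"
  shows "smooth_action (G\<lparr>carrier := H\<rparr>) HM Q l"
proof -
  have sub: "subgroup H G" and K: "lie_group (G\<lparr>carrier := H\<rparr>) HM" and \<iota>: "smooth_map HM GM (\<lambda>g. g)"
    using H by (auto simp: embedded_lie_subgroup_def)
  have GM: "smooth_manifold GM" and HM: "smooth_manifold HM" using G K by (auto simp: lie_group_def)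
  note ch = smooth_manifold_charted[OF GM] smooth_manifold_charted[OF HM] smooth_manifold_charted[OF Q]
  have "smooth_map (prod_manifold HM Q) (prod_manifold GM Q) (\<lambda>(x, y). (x, y))"
    by (rule smooth_map_prod_map[OF \<iota> smooth_map_id[OF Q]]) (use ch in auto)
  then have "smooth_map (prod_manifold HM Q) Q (\<lambda>x. (\<lambda>(g, q). l g q) ((\<lambda>(x, y). (x, y)) x))"
    by (rule smooth_map_compose)
      (use act ch in \<open>auto simp: smooth_action_def intro: charted_prod finite_dimensional_prod\<close>)
  then have "smooth_map (prod_manifold HM Q) Q (\<lambda>(g, q). l g q)" by (simp add: case_prod_unfold)
  then show ?thesis
    using act group_action.induced_action[OF _ sub] by (auto simp: smooth_action_def)
qed

theorem proposition3p24:
  fixes Q :: "('q, 'e::real_normed_vector) manifold"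
    and Ld :: "'q \<times> 'q \<Rightarrow> real"
    and G :: "'g monoid"
    and GM :: "('g, 'l::real_normed_vector) manifold"
    and l :: "'g \<Rightarrow> 'q \<Rightarrow> 'q"
    and \<mu> :: "'l \<Rightarrow> real"
    and K :: "'g monoid"
    and KM :: "('g, 'h::real_normed_vector) manifold"
    and \<nu> :: "'h \<Rightarrow> real"
    and B :: "('q set, 'b::real_normed_vector) manifold"
    and \<AA> :: "'q \<Rightarrow> 'e \<Rightarrow> 'h"
  defines "K \<equiv> G\<lparr>carrier := coadjoint_isotropy G GM \<mu>\<rparr>"
    and "\<nu> \<equiv> restrict_dual G GM KM \<mu>"
  assumes "smooth_manifold Q"
    and "smooth_map (prod_manifold Q Q) vec_manifold Ld"
    and "lie_group G GM"
    and "smooth_action G GM Q l"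
    and "free_action G Q l"
    and "proper_action GM Q l"
    and "invariant_lagrangian G Q l Ld"
    and "linear \<mu>"
    and "embedded_lie_subgroup G GM (coadjoint_isotropy G GM \<mu>) KM"
    and "quotient_principal_bundle K KM Q l B"
    and "good_symmetries K KM Q l Ld \<nu>"
    and "has_affine_discrete_connection K KM Q l Ld \<nu>"
    and "principal_connection K KM Q l \<AA>"
  shows "\<forall>\<tau>0\<in>mcarrier B. \<forall>\<tau>1\<in>mcarrier B. \<forall>\<delta>\<tau>0 \<delta>\<tau>1.
           f_breve K KM Q l Ld \<nu> B \<AA> (\<tau>0, \<tau>1) (\<delta>\<tau>0, \<delta>\<tau>1)
             = - A_breve K KM Q l Ld \<nu> B \<AA> (\<tau>0, \<tau>1) (\<delta>\<tau>0, \<delta>\<tau>1)"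
proof -
  let ?H = "coadjoint_isotropy G GM \<mu>" and ?T = "tangent_map KM GM (\<lambda>g. g) \<one>\<^bsub>G\<^esub>"
  have sub: "subgroup ?H G" and K: "lie_group K KM" and \<iota>: "smooth_map KM GM (\<lambda>g. g)"
    using assms(11) by (auto simp: embedded_lie_subgroup_def K_def)
  interpret G: group G using lie_group_manifold[OF assms(5)] by simp
  have one: "\<one>\<^bsub>G\<^esub> \<in> mcarrier KM"
    using lie_group_manifold(3)[OF K] subgroup.one_closed[OF sub] by (simp add: K_def)
  have "linear ?T"
    using smooth_map_has_tangent[OF \<iota> lie_group_manifold(1)[OF K] lie_group_manifold(1)[OF assms(5)] one]
    by (rule has_tangent_linear)
  from linear_compose[OF this assms(10)] have "linear \<nu>"
    by (simp add: \<nu>_def restrict_dual_def comp_def)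
  moreover have "\<nu> (Ad K KM k \<xi>) = \<nu> \<xi>" if k: "k \<in> carrier K" for k \<xi>
  proof -
    have kH: "k \<in> ?H" using k by (simp add: K_def)
    have kG: "k \<in> carrier G" using kH by (simp add: coadjoint_isotropy_def)
    have "inv\<^bsub>G\<^esub> k \<in> ?H" using sub kH by (rule subgroup.m_inv_closed)
    then have "Ad_star G GM k \<mu> = \<mu>" using kG by (simp add: coadjoint_isotropy_def)
    then have "\<mu> (Ad G GM k \<eta>) = \<mu> \<eta>" for \<eta> unfolding Ad_star_def by metis
    then show ?thesis
      using tangent_inclusion_Ad[OF assms(5,11) kH] by (simp add: \<nu>_def restrict_dual_def K_def)
  qed
  moreover have "smooth_action K KM Q l"
    unfolding K_def by (rule smooth_action_subgroup[OF assms(5,11,3,6)])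
  moreover have "invariant_lagrangian K Q l Ld"
    using assms(9) by (auto simp: invariant_lagrangian_def K_def coadjoint_isotropy_def)
  ultimately interpret discrete_symmetry K KM Q l Ld \<nu> B \<AA>
    by (intro discrete_symmetry.intro) (use K assms(3,4,12,14,15) in auto)
  show ?thesis using force_eq_minus_A_breve by blast
qed

end
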